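(* Let $\mathcal W$ be a discrete memoryless channel from a finite set $\mathcal X$ to a finite set $\mathcal Y$. Then $$E^{\rm NS}_0(\mathcal W)=E^{\rm NS}(0^+,\mathcal W)=E_{\rm sp}(0^+,\mathcal W)=U(\mathcal W),$$ with equalities in $[0,+\infty]$.
   Context: For probability distributions $P,Q$ on a finite set, $D(P\|Q)=\sum_x P(x)\log\frac{P(x)}{Q(x)}$ (with $0\log(0/q)=0$, and $D(P\|Q)=+\infty$ if $P$ is not absolutely continuous w.r.t. $Q$). For $\alpha\in(0,1)\cup(1,\infty)$, the Rényi divergence is $D_\alpha(P\|Q)=\frac{1}{\alpha-1}\log\sum_{x:P(x)>0}P(x)^\alpha Q(x)^{1-\alpha}$ (equal to $+\infty$ if $\alpha>1$ and $P\not\ll Q$). A discrete memoryless channel $\mathcal W$ from $\mathcal X$ to $\mathcal Y$ is a stochastic matrix $(\mathcal W(y|x))_{x,y}$; $\mathcal W^{\times n}(y^n|x^n)=\prod_{i=1}^n\mathcal W(y_i|x_i)$. For $P_X\in\mathcal P(\mathcal X)$ write $P_{XY}(x,y)=P_X(x)\mathcal W(y|x)$. The channel umlaut information is $U(\mathcal W)=\max_{P_X\in\mathcal P(\mathcal X)}\min_{Q_Y\in\mathcal P(\mathcal Y)}D(P_X\times Q_Y\|P_{XY})$. Non-signalling (NS) codes: for message set $[M]=\{1,\dots,M\}$ and a channel $\mathcal W$ from $\mathcal X$ to $\mathcal Y$, an NS code is a conditional distribution $\mathcal Z(x,\hat w\mid y,w)$ ($x\in\mathcal X,\hat w\in[M],y\in\mathcal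 Y,w\in[M]$) such that $\sum_x\mathcal Z(x,\hat w\mid y,w)$ does not depend on $w$ and $\sum_{\hat w}\mathcal Z(x,\hat w\mid y,w)$ does not depend on $y$. Its error probability with a uniformly distributed message is $1-\frac1M\sum_{w\in[M]}\sum_{x,y}\mathcal W(y|x)\mathcal Z(x,w\mid y,w)$, and $\epsilon^{\rm NS}(M,\mathcal W)$ is the minimum of this over all NS codes. Define $E^{\rm NS}(r,\mathcal W)=\liminf_{n\to\infty}-\frac1n\log\epsilon^{\rm NS}(\lceil e^{rn}\rceil,\mathcal W^{\times n})$, $E^{\rm NS}(0^+,\mathcal W)=\liminf_{r\to0^+}E^{\rm NS}(r,\mathcal W)$, and $E^{\rm NS}_0(\mathcal W)=\liminf_{M\to\infty}\liminf_{n\to\infty}-\frac1n\log\epsilon^{\rm NS}(M,\mathcal W^{\times n})$. Sphere-packing exponent: for $r>0$, $E_{\rm sp}(r,\mathcal W)=\sup_{\alpha\in(0,1]}\max_{P_X}\min_{Q_Y}\frac{1-\alpha}{\alpha}\big(D_\alpha(P_{XY}\|P_X\times Q_Y)-r\big)$ (the term for $\alpha=1$ being $0$), and $E_{\rm sp}(0^+,\mathcal W)=\lim_{r\to0^+}E_{\rm sp}(r,\mathcal W)$. *)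

theory Defs
  imports "HOL-Analysis.Analysis"
begin

definition pd :: "('a::finite \<Rightarrow> real) \<Rightarrow> bool" where
  "pd P \<longleftrightarrow> (\<forall>a. 0 \<le> P a) \<and> sum P UNIV = 1"

definition is_channel :: "('x::finite \<Rightarrow> 'y::finite \<Rightarrow> real) \<Rightarrow> bool" where
  "is_channel W \<longleftrightarrow> (\<forall>x y. 0 \<le> W x y) \<and> (\<forall>x. (\<Sum>y\<in>UNIV. W x y) = 1)"

definition KL :: "('a::finite \<Rightarrow> real) \<Rightarrow> ('a \<Rightarrow> real) \<Rightarrow> ereal" where
  "KL P Q = (if (\<exists>a. 0 < P a \<and> Q a = 0) then \<infinity>
             else ereal (\<Sum>a\<in>{a. 0 < P a}. P a * ln (P a / Q a)))"

text \<open>Renyi divergence of order alpha (alpha in (0,1) or (1,inf)).\<close>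
definition renyi :: "real \<Rightarrow> ('a::finite \<Rightarrow> real) \<Rightarrow> ('a \<Rightarrow> real) \<Rightarrow> ereal" where
  "renyi \<alpha> P Q =
     (let s = (\<Sum>a\<in>{a. 0 < P a}. P a powr \<alpha> * Q a powr (1 - \<alpha>)) in
      if 1 < \<alpha> \<and> (\<exists>a. 0 < P a \<and> Q a = 0) then \<infinity>
      else if s = 0 then \<infinity>
      else ereal (ln s / (\<alpha> - 1)))"

definition joint :: "('x \<Rightarrow> real) \<Rightarrow> ('x \<Rightarrow> 'y \<Rightarrow> real) \<Rightarrow> 'x \<times> 'y \<Rightarrow> real" where
  "joint P W = (\<lambda>(x, y). P x * W x y)"

definition prodd :: "('x \<Rightarrow> real) \<Rightarrow> ('y \<Rightarrow> real) \<Rightarrow> 'x \<times> 'y \<Rightarrow> real" where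
  "prodd P Q = (\<lambda>(x, y). P x * Q y)"

definition umlaut :: "('x::finite \<Rightarrow> 'y::finite \<Rightarrow> real) \<Rightarrow> ereal" where
  "umlaut W = (SUP P\<in>{P. pd P}. INF Q\<in>{Q. pd Q}. KL (prodd P Q) (joint P W))"

definition E_sp :: "('x::finite \<Rightarrow> 'y::finite \<Rightarrow> real) \<Rightarrow> real \<Rightarrow> ereal" where
  "E_sp W r = (SUP \<alpha>\<in>{0<..1}.
      (if \<alpha> = 1 then 0
       else (SUP P\<in>{P. pd P}. INF Q\<in>{Q. pd Q}.
               ereal ((1 - \<alpha>) / \<alpha>) * (renyi \<alpha> (joint P W) (prodd P Q) - ereal r))))"

text \<open>Non-signalling codes for a channel Wc from a finite set Xs to a finite set Ys,
  message set {1..M}. Z x wh y w stands for Z(x, wh | y, w).\<close>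
definition NS_code :: "'a set \<Rightarrow> 'b set \<Rightarrow> nat \<Rightarrow> ('a \<Rightarrow> nat \<Rightarrow> 'b \<Rightarrow> nat \<Rightarrow> real) \<Rightarrow> bool" where
  "NS_code Xs Ys M Z \<longleftrightarrow>
     (\<forall>x\<in>Xs. \<forall>wh\<in>{1..M}. \<forall>y\<in>Ys. \<forall>w\<in>{1..M}. 0 \<le> Z x wh y w) \<and>
     (\<forall>y\<in>Ys. \<forall>w\<in>{1..M}. (\<Sum>x\<in>Xs. \<Sum>wh\<in>{1..M}. Z x wh y w) = 1) \<and>
     (\<forall>wh\<in>{1..M}. \<forall>y\<in>Ys. \<forall>w\<in>{1..M}. \<forall>w'\<in>{1..M}.
        (\<Sum>x\<in>Xs. Z x wh y w) = (\<Sum>x\<in>Xs. Z x wh y w')) \<and>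
     (\<forall>x\<in>Xs. \<forall>y\<in>Ys. \<forall>y'\<in>Ys. \<forall>w\<in>{1..M}.
        (\<Sum>wh\<in>{1..M}. Z x wh y w) = (\<Sum>wh\<in>{1..M}. Z x wh y' w))"

definition NS_error :: "'a set \<Rightarrow> 'b set \<Rightarrow> ('a \<Rightarrow> 'b \<Rightarrow> real) \<Rightarrow> nat
                        \<Rightarrow> ('a \<Rightarrow> nat \<Rightarrow> 'b \<Rightarrow> nat \<Rightarrow> real) \<Rightarrow> real" where
  "NS_error Xs Ys Wc M Z =
     1 - (1 / real M) * (\<Sum>w\<in>{1..M}. \<Sum>x\<in>Xs. \<Sum>y\<in>Ys. Wc x y * Z x w y w)"

definition eps_NS :: "'a set \<Rightarrow> 'b set \<Rightarrow> ('a \<Rightarrow> 'b \<Rightarrow> real) \<Rightarrow> nat \<Rightarrow> real" where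
  "eps_NS Xs Ys Wc M = Inf {NS_error Xs Ys Wc M Z | Z. NS_code Xs Ys M Z}"

definition words :: "nat \<Rightarrow> 'a list set" where
  "words n = {xs. length xs = n}"

definition chan_pow :: "('x \<Rightarrow> 'y \<Rightarrow> real) \<Rightarrow> nat \<Rightarrow> 'x list \<Rightarrow> 'y list \<Rightarrow> real" where
  "chan_pow W n xs ys = (\<Prod>i<n. W (xs ! i) (ys ! i))"

definition eps_NS_n :: "('x::finite \<Rightarrow> 'y::finite \<Rightarrow> real) \<Rightarrow> nat \<Rightarrow> nat \<Rightarrow> real" where
  "eps_NS_n W M n = eps_NS (words n) (words n) (chan_pow W n) M"

definition rate :: "nat \<Rightarrow> real \<Rightarrow> ereal" where
  "rate n e = (if e \<le> 0 then \<infinity> else ereal (- ln e / real n))"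

definition E_NS :: "('x::finite \<Rightarrow> 'y::finite \<Rightarrow> real) \<Rightarrow> real \<Rightarrow> ereal" where
  "E_NS W r = Liminf sequentially
      (\<lambda>n. rate n (eps_NS_n W (nat \<lceil>exp (r * real n)\<rceil>) n))"

definition E_NS_0plus :: "('x::finite \<Rightarrow> 'y::finite \<Rightarrow> real) \<Rightarrow> ereal" where
  "E_NS_0plus W = Liminf (at_right 0) (E_NS W)"

definition E_NS_zero :: "('x::finite \<Rightarrow> 'y::finite \<Rightarrow> real) \<Rightarrow> ereal" where
  "E_NS_zero W = Liminf sequentially (\<lambda>M. Liminf sequentially (\<lambda>n. rate n (eps_NS_n W M n)))"

end

theory Submission
  imports Defs
begin

text \<open>
  Write $S_\alpha(P) = \sum_y (\sum_x P(x) W(y|x)^\alpha)^{1/\alpha}$. Sibson's identity evaluates the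
  inner minimum of the sphere-packing exponent to $-\ln S_\alpha(P) - \frac{1-\alpha}{\alpha} r$, and
  Gibbs' principle evaluates that of the umlaut information to
  $-\ln \sum_y \prod_x W(y|x)^{P(x)}$, the limit of $-\ln S_\alpha(P)$ as $\alpha \to 0$. Hence
  $U \le \liminf_{r \to 0} E_{sp}(r)$.

  Achievability: the threshold test $W^n(y|x) \ge q_y$ with
  $q_y = (M \sum_x P^n(x) W^n(y|x)^\alpha)^{1/\alpha}$ turns into a non-signalling code of error at
  most $M^{(1-\alpha)/\alpha} S_\alpha(P)^n$, so $E_{sp}$ is below both non-signalling exponents.

  Converse: by weak duality, every $q \ge 0$ gives the lower bound
  $\min_x \sum_y \min(W(y|x), q_y) - \frac{1}{M} \sum_y q_y$ on the error. Take $q = t Q^n$, where $Q$ comes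
  from the stationarity conditions at a minimiser of $P \mapsto \sum_y \prod_x W(y|x)^{P(x)}$, which
  give $D(Q \| W(\cdot|x)) \le U$ for every $x$; a Markov-type estimate then suffices, no law of
  large numbers being needed because $\frac1M$ may be taken arbitrarily small.
\<close>


section \<open>One-shot bounds for non-signalling codes\<close>

text \<open>Weak linear programming duality with dual variable \<open>q\<close>. In the success
  probability \<open>V x y\<close> is split into its excess over \<open>min (V x y) (q y)\<close>
  and that minimum. In the excess part \<open>Z x w y w\<close> is bounded by the encoder marginal,
  which does not see \<open>y\<close>; in the other part the minimum is bounded by
  \<open>q y\<close>, and the decoder marginals sum to one over the messages.\<close>

lemma NS_error_ge:
  assumes code: "NS_code Xs Ys M Z" and M: "1 \<le> M"
    and ne: "Ys \<noteq> {}"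
    and V1: "\<And>x. x \<in> Xs \<Longrightarrow> (\<Sum>y\<in>Ys. V x y) = 1"
    and K: "\<And>x. x \<in> Xs \<Longrightarrow> K \<le> (\<Sum>y\<in>Ys. min (V x y) (q y))"
  shows "K - sum q Ys / real M \<le> NS_error Xs Ys V M Z"
proof -
  obtain y0 where y0: "y0 \<in> Ys" using ne by blast
  have M1: "1 \<in> {1..M}" using M by simp
  have Z0: "0 \<le> Z x wh y w" if "x \<in> Xs" "wh \<in> {1..M}" "y \<in> Ys" "w \<in> {1..M}" for x wh y w
    using code that unfolding NS_code_def by blast
  have Z1: "(\<Sum>x\<in>Xs. \<Sum>wh\<in>{1..M}. Z x wh y w) = 1" if "y \<in> Ys" "w \<in> {1..M}" for y w
    using code that unfolding NS_code_def by blast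
  \<comment> \<open>\<open>z\<close> is the encoder marginal and \<open>s\<close> the decoder
    marginal. By the two non-signalling conditions the reference values \<open>y0\<close> and
    \<open>1\<close> are arbitrary.\<close>
  define z where "z x w = (\<Sum>wh\<in>{1..M}. Z x wh y0 w)" for x w
  define s where "s wh y = (\<Sum>x\<in>Xs. Z x wh y 1)" for wh y
  have z: "(\<Sum>wh\<in>{1..M}. Z x wh y w) = z x w" if "x \<in> Xs" "y \<in> Ys" "w \<in> {1..M}" for x y w
    using code that y0 unfolding NS_code_def z_def by blast
  have s: "(\<Sum>x\<in>Xs. Z x wh y w) = s wh y" if "wh \<in> {1..M}" "y \<in> Ys" "w \<in> {1..M}" for wh y w
    using code that M1 unfolding NS_code_def s_def by blast
  have z0: "0 \<le> z x w" if "x \<in> Xs" "w \<in> {1..M}" for x w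
    unfolding z_def using Z0 that y0 by (intro sum_nonneg) auto
  have zs: "(\<Sum>x\<in>Xs. z x w) = 1" if "w \<in> {1..M}" for w
    unfolding z_def using Z1[OF y0 that] .
  have ss: "(\<Sum>w\<in>{1..M}. s w y) = 1" if "y \<in> Ys" for y
    unfolding s_def using Z1[OF that M1] by (subst sum.swap)
  have Zz: "Z x w y w \<le> z x w" if "x \<in> Xs" "y \<in> Ys" "w \<in> {1..M}" for x y w
    unfolding z[OF that, symmetric] using Z0 that by (intro member_le_sum) auto
  have per: "(\<Sum>x\<in>Xs. \<Sum>y\<in>Ys. V x y * Z x w y w) \<le> (1 - K) + (\<Sum>y\<in>Ys. q y * s w y)"
    if w: "w \<in> {1..M}" for w
  proof -
    have "(\<Sum>x\<in>Xs. \<Sum>y\<in>Ys. V x y * Z x w y w)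
        \<le> (\<Sum>x\<in>Xs. \<Sum>y\<in>Ys. (V x y - min (V x y) (q y)) * z x w + q y * Z x w y w)"
    proof (intro sum_mono)
      fix x y assume xy: "x \<in> Xs" "y \<in> Ys"
      have "(V x y - min (V x y) (q y)) * Z x w y w \<le> (V x y - min (V x y) (q y)) * z x w"
        using Zz[OF xy w] by (intro mult_left_mono) auto
      moreover have "min (V x y) (q y) * Z x w y w \<le> q y * Z x w y w"
        using Z0 xy w by (intro mult_right_mono) auto
      ultimately show "V x y * Z x w y w \<le> (V x y - min (V x y) (q y)) * z x w + q y * Z x w y w"
        by (simp add: algebra_simps)
    qed
    also have "\<dots> = (\<Sum>x\<in>Xs. (1 - (\<Sum>y\<in>Ys. min (V x y) (q y))) * z x w)
                    + (\<Sum>y\<in>Ys. q y * (\<Sum>x\<in>Xs. Z x w y w))"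
    proof -
      have "(\<Sum>x\<in>Xs. \<Sum>y\<in>Ys. q y * Z x w y w) = (\<Sum>y\<in>Ys. q y * (\<Sum>x\<in>Xs. Z x w y w))"
        by (subst sum.swap) (simp add: sum_distrib_left)
      moreover have "(\<Sum>x\<in>Xs. \<Sum>y\<in>Ys. (V x y - min (V x y) (q y)) * z x w)
         = (\<Sum>x\<in>Xs. (1 - (\<Sum>y\<in>Ys. min (V x y) (q y))) * z x w)"
        by (intro sum.cong refl) (simp add: sum_distrib_right[symmetric] sum_subtractf V1)
      ultimately show ?thesis by (simp add: sum.distrib)
    qed
    also have "(\<Sum>x\<in>Xs. (1 - (\<Sum>y\<in>Ys. min (V x y) (q y))) * z x w) \<le> (\<Sum>x\<in>Xs. (1 - K) * z x w)"
      using K z0 w by (intro sum_mono mult_right_mono) auto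
    also have "\<dots> = 1 - K" using zs[OF w] by (simp add: sum_distrib_left[symmetric])
    also have "(\<Sum>y\<in>Ys. q y * (\<Sum>x\<in>Xs. Z x w y w)) = (\<Sum>y\<in>Ys. q y * s w y)"
      using s w by (intro sum.cong) auto
    finally show ?thesis by simp
  qed
  have "(\<Sum>w\<in>{1..M}. \<Sum>x\<in>Xs. \<Sum>y\<in>Ys. V x y * Z x w y w)
      \<le> (\<Sum>w\<in>{1..M}. (1 - K) + (\<Sum>y\<in>Ys. q y * s w y))"
    using per by (intro sum_mono) auto
  also have "\<dots> = real M * (1 - K) + (\<Sum>w\<in>{1..M}. \<Sum>y\<in>Ys. q y * s w y)"
    by (simp add: sum.distrib)
  also have "(\<Sum>w\<in>{1..M}. \<Sum>y\<in>Ys. q y * s w y) = (\<Sum>y\<in>Ys. q y * (\<Sum>w\<in>{1..M}. s w y))"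
    by (subst sum.swap) (simp add: sum_distrib_left)
  also have "\<dots> = sum q Ys" using ss by (intro sum.cong) auto
  finally have "(\<Sum>w\<in>{1..M}. \<Sum>x\<in>Xs. \<Sum>y\<in>Ys. V x y * Z x w y w) / real M
      \<le> (real M * (1 - K) + sum q Ys) / real M"
    using M by (intro divide_right_mono) auto
  also have "\<dots> = (1 - K) + sum q Ys / real M" using M by (simp add: add_divide_distrib)
  finally show ?thesis unfolding NS_error_def by simp
qed

text \<open>The converse direction of the link with hypothesis testing. When the input is drawn from
  \<open>p\<close> independently of the output, \<open>T\<close> accepts with probability at most
  \<open>1 / M\<close>, the chance of guessing the message blindly. The code guesses right at least
  where \<open>T\<close> accepts, so its error is at most the probability of rejecting under the
  true joint law.\<close>

lemma NS_code_of_test: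
  assumes M: "2 \<le> M"
    and V0: "\<And>x y. x \<in> Xs \<Longrightarrow> y \<in> Ys \<Longrightarrow> 0 \<le> V x y"
    and V1: "\<And>x. x \<in> Xs \<Longrightarrow> (\<Sum>y\<in>Ys. V x y) = 1"
    and p0: "\<And>x. x \<in> Xs \<Longrightarrow> 0 \<le> p x" and p1: "sum p Xs = 1"
    and T: "\<And>x y. x \<in> Xs \<Longrightarrow> y \<in> Ys \<Longrightarrow> 0 \<le> T x y \<and> T x y \<le> 1"
    and TM: "\<And>y. y \<in> Ys \<Longrightarrow> (\<Sum>x\<in>Xs. p x * T x y) \<le> 1 / real M"
  obtains Z where "NS_code Xs Ys M Z"
    and "NS_error Xs Ys V M Z \<le> (\<Sum>y\<in>Ys. \<Sum>x\<in>Xs. p x * V x y * (1 - T x y))"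
proof -
  define c where "c y = (\<Sum>x\<in>Xs. p x * T x y)" for y
  define l where "l y = (1 / real M - c y) / (1 - c y)" for y
  \<comment> \<open>Mixing in the trivial test with weight l y makes every column sum of R equal to 1/M,
    which is what the non-signalling condition on the decoder side needs.\<close>
  define R where "R x y = p x * (T x y + (1 - T x y) * l y)" for x y
  \<comment> \<open>The mass of \<open>p x\<close> left over by \<open>R x y\<close> is spread
    evenly over the \<open>M - 1\<close> wrong guesses. Summing over guesses then returns
    \<open>p x\<close>, and every guess has total mass \<open>1 / M\<close>, so both non-signalling
    conditions hold.\<close>
  define Z where "Z x wh y w = (if wh = w then R x y else (p x - R x y) / (real M - 1))"
    for x y and wh w :: nat
  have M1: "1 / real M < 1" using M by simp
  have c: "c y \<le> 1 / real M" "c y < 1" if "y \<in> Ys" for y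
    using TM[OF that] M1 unfolding c_def by linarith+
  have l: "0 \<le> l y" "l y \<le> 1" if "y \<in> Ys" for y
    using c[OF that] M1 unfolding l_def by (auto simp: divide_le_eq)
  have R0: "0 \<le> R x y" if "x \<in> Xs" "y \<in> Ys" for x y
    unfolding R_def using p0 T l that by auto
  have Rp: "R x y \<le> p x" if "x \<in> Xs" "y \<in> Ys" for x y
  proof -
    have "T x y + (1 - T x y) * l y \<le> T x y + (1 - T x y) * 1"
      using T l that by (intro add_left_mono mult_left_mono) auto
    then show ?thesis unfolding R_def using p0[OF that(1)] mult_left_mono[of _ 1 "p x"] by simp
  qed
  have Rs: "(\<Sum>x\<in>Xs. R x y) = 1 / real M" if "y \<in> Ys" for y
  proof -
    have "(\<Sum>x\<in>Xs. R x y) = c y + l y * (1 - c y)"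
      unfolding R_def c_def
      by (simp add: algebra_simps sum.distrib sum_subtractf sum_distrib_left p1 sum_distrib_left[symmetric, of "l y" p])
    then show ?thesis using c[OF that] by (simp add: l_def)
  qed
  have card: "card ({1..M} - {w}) = M - 1" if "w \<in> {1..M}" for w using that by simp
  have Zsum: "(\<Sum>wh\<in>{1..M}. Z x wh y w) = p x" if "w \<in> {1..M}" for x y w
  proof -
    have "(\<Sum>wh\<in>{1..M}. Z x wh y w) = Z x w y w + (\<Sum>wh\<in>{1..M} - {w}. Z x wh y w)"
      using that by (intro sum.remove) auto
    also have "(\<Sum>wh\<in>{1..M} - {w}. Z x wh y w) = (\<Sum>wh\<in>{1..M} - {w}. (p x - R x y) / (real M - 1))"
      by (intro sum.cong) (auto simp: Z_def)
    also have "\<dots> = p x - R x y" using card[OF that] M by (simp add: of_nat_diff)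
    finally show ?thesis by (simp add: Z_def)
  qed
  have Zx: "(\<Sum>x\<in>Xs. Z x wh y w) = 1 / real M" if "y \<in> Ys" for wh y w
  proof (cases "wh = w")
    case False
    then have "(\<Sum>x\<in>Xs. Z x wh y w) = (1 - 1 / real M) / (real M - 1)"
      using Rs[OF that] by (simp add: Z_def sum_divide_distrib[symmetric] sum_subtractf p1)
    also have "\<dots> = 1 / real M" using M by (simp add: divide_simps)
    finally show ?thesis .
  qed (simp add: Z_def Rs that)
  have "NS_code Xs Ys M Z"
    unfolding NS_code_def
  proof (intro conjI ballI)
    fix x y wh w assume "x \<in> Xs" "y \<in> Ys"
    then show "0 \<le> Z x wh y w" using R0 Rp M by (auto simp: Z_def)
  qed (simp_all add: Zsum Zx p1 del: One_nat_def atLeastAtMost_iff)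
  moreover have "NS_error Xs Ys V M Z \<le> (\<Sum>y\<in>Ys. \<Sum>x\<in>Xs. p x * V x y * (1 - T x y))"
  proof -
    have "NS_error Xs Ys V M Z = 1 - (\<Sum>x\<in>Xs. \<Sum>y\<in>Ys. V x y * R x y)"
      using M by (simp add: NS_error_def Z_def)
    also have "1 = (\<Sum>x\<in>Xs. \<Sum>y\<in>Ys. V x y * p x)"
      by (simp add: V1 p1 sum_distrib_right[symmetric])
    also have "\<dots> - (\<Sum>x\<in>Xs. \<Sum>y\<in>Ys. V x y * R x y) = (\<Sum>x\<in>Xs. \<Sum>y\<in>Ys. V x y * (p x - R x y))"
      by (simp add: sum_subtractf algebra_simps)
    also have "\<dots> \<le> (\<Sum>x\<in>Xs. \<Sum>y\<in>Ys. V x y * (p x - p x * T x y))"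
      using V0 p0 T l by (intro sum_mono mult_left_mono) (auto simp: R_def algebra_simps mult_left_mono mult_left_le)
    also have "\<dots> = (\<Sum>y\<in>Ys. \<Sum>x\<in>Xs. p x * V x y * (1 - T x y))"
      by (subst sum.swap) (simp add: algebra_simps)
    finally show ?thesis .
  qed
  ultimately show ?thesis using that by blast
qed

section \<open>Memoryless extensions\<close>

lemma words_Suc: "words (Suc n) = (\<lambda>(y, ys). y # ys) ` (UNIV \<times> words n)"
  by (auto simp: words_def length_Suc_conv)

lemma finite_words: "finite (words n :: 'a::finite list set)"
  by (induction n) (auto simp: words_Suc, simp add: words_def)

lemma words_nonempty: "words n \<noteq> {}"
  unfolding words_def by (metis (mono_tags, lifting) empty_iff length_replicate mem_Collect_eq)

lemma sum_words_Suc: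
  fixes f :: "'a::finite list \<Rightarrow> real"
  shows "(\<Sum>ys\<in>words (Suc n). f ys) = (\<Sum>y\<in>UNIV. \<Sum>ys\<in>words n. f (y # ys))"
  unfolding words_Suc
  by (subst sum.reindex) (auto simp: inj_on_def sum.cartesian_product intro!: sum.cong)

text \<open>The factors may depend on the position, since the other word of a channel use enters as
  a fixed parameter.\<close>

lemma sum_words_prod:
  fixes f :: "nat \<Rightarrow> 'a::finite \<Rightarrow> real"
  shows "(\<Sum>ys\<in>words n. \<Prod>i<n. f i (ys ! i)) = (\<Prod>i<n. \<Sum>y\<in>UNIV. f i y)"
proof (induction n arbitrary: f)
  case 0
  then show ?case by (simp add: words_def)
next
  case (Suc n)
  show ?case
    by (simp add: sum_words_Suc prod.lessThan_Suc_shift Suc.IH[of "\<lambda>i. f (Suc i)"]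
        sum_distrib_left[symmetric] sum_distrib_right[symmetric] del: prod.lessThan_Suc)
qed

text \<open>Linearity of expectation for an additive function under the product distribution of
  \<open>Q\<close>, proved without assuming \<open>Q\<close> nonnegative.\<close>

lemma sum_words_prod_sum:
  fixes Q :: "'a::finite \<Rightarrow> real" and f :: "nat \<Rightarrow> 'a \<Rightarrow> real"
  assumes "sum Q UNIV = 1"
  shows "(\<Sum>ys\<in>words n. (\<Prod>i<n. Q (ys ! i)) * (\<Sum>i<n. f i (ys ! i))) = (\<Sum>i<n. \<Sum>y\<in>UNIV. Q y * f i y)"
proof (induction n arbitrary: f)
  case 0
  then show ?case by simp
next
  case (Suc n)
  have 1: "(\<Sum>ys\<in>words n. \<Prod>i<n. Q (ys ! i)) = 1"
    using sum_words_prod[of "\<lambda>_. Q" n] assms by simp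
  have "(\<Sum>ys\<in>words (Suc n). (\<Prod>i<Suc n. Q (ys ! i)) * (\<Sum>i<Suc n. f i (ys ! i)))
      = (\<Sum>y\<in>UNIV. \<Sum>ys\<in>words n. Q y * f 0 y * (\<Prod>i<n. Q (ys ! i))
           + Q y * ((\<Prod>i<n. Q (ys ! i)) * (\<Sum>i<n. f (Suc i) (ys ! i))))"
    by (simp add: sum_words_Suc prod.lessThan_Suc_shift sum.lessThan_Suc_shift algebra_simps
        del: prod.lessThan_Suc sum.lessThan_Suc)
  also have "\<dots> = (\<Sum>y\<in>UNIV. Q y * f 0 y + Q y * (\<Sum>i<n. \<Sum>y\<in>UNIV. Q y * f (Suc i) y))"
    by (simp add: sum.distrib sum_distrib_left[symmetric] 1 Suc.IH[of "\<lambda>i. f (Suc i)"])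
  also have "\<dots> = (\<Sum>i<Suc n. \<Sum>y\<in>UNIV. Q y * f i y)"
    by (simp add: sum.distrib sum_distrib_right[symmetric] assms sum.lessThan_Suc_shift
        del: sum.lessThan_Suc)
  finally show ?case .
qed


lemma chan_pow_nonneg: "is_channel W \<Longrightarrow> 0 \<le> chan_pow W n xs ys"
  by (auto simp: chan_pow_def is_channel_def intro: prod_nonneg)

lemma sum_chan_pow: "is_channel W \<Longrightarrow> (\<Sum>ys\<in>words n. chan_pow W n xs ys) = 1"
  unfolding chan_pow_def by (subst sum_words_prod) (simp add: is_channel_def)

text \<open>A real infimum lies below its elements only if the set is bounded below; the duality
  bound with \<open>q = 0\<close> and \<open>K = 0\<close> shows that errors are
  nonnegative.\<close>

lemma eps_NS_n_le_error:
  fixes W :: "'x::finite \<Rightarrow> 'y::finite \<Rightarrow> real"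
  assumes W: "is_channel W" and M: "1 \<le> M" and Z: "NS_code (words n) (words n) M Z"
  shows "eps_NS_n W M n \<le> NS_error (words n) (words n) (chan_pow W n) M Z"
  unfolding eps_NS_n_def eps_NS_def
proof (rule cInf_lower)
  show "bdd_below {NS_error (words n) (words n) (chan_pow W n) M Z |Z. NS_code (words n) (words n) M Z}"
  proof (rule bdd_belowI[of _ 0], clarify)
    fix Z :: "'x list \<Rightarrow> nat \<Rightarrow> 'y list \<Rightarrow> nat \<Rightarrow> real"
    assume "NS_code (words n) (words n) M Z"
    from NS_error_ge[OF this M words_nonempty, where V = "chan_pow W n" and q = "\<lambda>_. 0" and K = 0]
    show "0 \<le> NS_error (words n) (words n) (chan_pow W n) M Z"
      using W by (simp add: chan_pow_nonneg sum_chan_pow)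
  qed
qed (use Z in blast)

text \<open>The duality bound passes to the infimum once some code exists; the test that always
  rejects supplies one.\<close>

lemma eps_NS_n_ge:
  fixes W :: "'x::finite \<Rightarrow> 'y::finite \<Rightarrow> real"
  assumes W: "is_channel W" and M: "2 \<le> M"
    and K: "\<And>xs. xs \<in> words n \<Longrightarrow> K \<le> (\<Sum>ys\<in>words n. min (chan_pow W n xs ys) (q ys))"
  shows "K - sum q (words n) / real M \<le> eps_NS_n W M n"
  unfolding eps_NS_n_def eps_NS_def
proof (rule cInf_greatest)
  obtain x0 :: "'x list" where x0: "x0 \<in> words n" using words_nonempty by blast
  obtain Z :: "'x list \<Rightarrow> nat \<Rightarrow> 'y list \<Rightarrow> nat \<Rightarrow> real"
    where "NS_code (words n) (words n) M Z"
    by (rule NS_code_of_test[OF M, of "words n" "words n" "chan_pow W n"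
          "\<lambda>x. if x = x0 then 1 else 0" "\<lambda>_ _. 0"])
      (use W x0 in \<open>auto simp: chan_pow_nonneg sum_chan_pow finite_words\<close>)
  then show "{NS_error (words n) (words n) (chan_pow W n) M Z |Z. NS_code (words n) (words n) M Z} \<noteq> {}"
    by blast
next
  fix e assume "e \<in> {NS_error (words n) (words n) (chan_pow W n) M Z |Z. NS_code (words n) (words n) M Z}"
  then obtain Z where Z: "NS_code (words n) (words n) M Z"
    and e: "e = NS_error (words n) (words n) (chan_pow W n) M Z" by blast
  show "K - sum q (words n) / real M \<le> e" unfolding e
    by (rule NS_error_ge[OF Z])
      (use M W K in \<open>auto simp: chan_pow_nonneg sum_chan_pow finite_words words_nonempty\<close>)
qed

text \<open>Again by the test that always rejects. The bound makes the rates nonnegative, which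
  handles the term \<alpha> = 1 of the sphere-packing exponent.\<close>

lemma eps_NS_n_le_1:
  fixes W :: "'x::finite \<Rightarrow> 'y::finite \<Rightarrow> real"
  assumes W: "is_channel W" and M: "2 \<le> M"
  shows "eps_NS_n W M n \<le> 1"
proof -
  obtain x0 :: "'x list" where x0: "x0 \<in> words n" using words_nonempty by blast
  define p where "p x = (if x = x0 then 1 else 0 :: real)" for x
  have p1: "sum p (words n) = 1" using x0 by (simp add: p_def finite_words)
  obtain Z where Z: "NS_code (words n) (words n) M Z"
    and le: "NS_error (words n) (words n) (chan_pow W n) M Z
      \<le> (\<Sum>ys\<in>words n. \<Sum>xs\<in>words n. p xs * chan_pow W n xs ys * (1 - 0))"
    by (rule NS_code_of_test[OF M, of "words n" "words n" "chan_pow W n" p "\<lambda>_ _. 0"])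
      (use W p1 in \<open>auto simp: chan_pow_nonneg sum_chan_pow finite_words p_def\<close>)
  have "eps_NS_n W M n \<le> NS_error (words n) (words n) (chan_pow W n) M Z"
    using eps_NS_n_le_error[OF W _ Z] M by simp
  also note le
  also have "(\<Sum>ys\<in>words n. \<Sum>xs\<in>words n. p xs * chan_pow W n xs ys * (1 - 0)) = 1"
    by (subst sum.swap) (simp add: sum_distrib_left[symmetric] sum_chan_pow W p1)
  finally show ?thesis .
qed

section \<open>Achievability by a threshold test\<close>

definition tilted :: "real \<Rightarrow> ('x::finite \<Rightarrow> real) \<Rightarrow> ('x \<Rightarrow> 'y \<Rightarrow> real) \<Rightarrow> 'y \<Rightarrow> real" where
  "tilted \<alpha> P W y = (\<Sum>x\<in>UNIV. P x * W x y powr \<alpha>)"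

text \<open>With \<rho> = (1 - \<alpha>) / \<alpha> this is exp (- E_0(\<rho>, P)) for Gallager's
  function E_0.\<close>

definition tilted_sum :: "real \<Rightarrow> ('x::finite \<Rightarrow> real) \<Rightarrow> ('x \<Rightarrow> 'y::finite \<Rightarrow> real) \<Rightarrow> real" where
  "tilted_sum \<alpha> P W = (\<Sum>y\<in>UNIV. tilted \<alpha> P W y powr (1 / \<alpha>))"

lemma tilted_nonneg: "pd P \<Longrightarrow> 0 \<le> tilted \<alpha> P W y"
  by (auto simp: tilted_def pd_def intro!: sum_nonneg)

lemma tilted_sum_pos:
  assumes W: "is_channel W" and P: "pd P"
  shows "0 < tilted_sum \<alpha> P W"
proof -
  have "\<exists>x. P x \<noteq> 0" using P unfolding pd_def by (metis sum.neutral zero_neq_one)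
  then obtain x where x: "P x \<noteq> 0" by blast
  have "\<exists>y. W x y \<noteq> 0" using W unfolding is_channel_def by (metis sum.neutral zero_neq_one)
  then obtain y where y: "W x y \<noteq> 0" by blast
  have "0 < tilted \<alpha> P W y"
    unfolding tilted_def using P x y by (intro sum_pos2[of _ x]) (auto simp: pd_def order_less_le)
  then show ?thesis
    unfolding tilted_sum_def by (intro sum_pos2[of _ y]) auto
qed

text \<open>Inputs are drawn from the product of \<open>P\<close>. The threshold \<open>q\<close> is
  the one for which Markov's inequality gives acceptance probability at most \<open>1 / M\<close>;
  where the test rejects, \<open>V\<close> is at most
  \<open>V powr \<alpha> * q powr (1 - \<alpha>)\<close>. The resulting bound is a product over
  positions, so its sum over words is an n-th power.\<close>

lemma eps_NS_n_le_tilted_sum: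
  fixes W :: "'x::finite \<Rightarrow> 'y::finite \<Rightarrow> real"
  assumes W: "is_channel W" and P: "pd P" and a: "0 < \<alpha>" "\<alpha> < 1" and M: "2 \<le> M"
  shows "eps_NS_n W M n \<le> real M powr ((1 - \<alpha>) / \<alpha>) * tilted_sum \<alpha> P W ^ n"
proof -
  define p where "p xs = (\<Prod>i<n. P (xs ! i))" for xs
  define V where "V = chan_pow W n"
  define B where "B ys = (\<Prod>i<n. tilted \<alpha> P W (ys ! i))" for ys
  define q where "q ys = (real M * B ys) powr (1 / \<alpha>)" for ys
  \<comment> \<open>If \<open>B ys\<close> is zero, so is \<open>q ys\<close>, and without the guard
    every input would be accepted, against the bound \<open>1 / M\<close>.\<close>
  define T where "T xs ys = (if 0 < B ys \<and> q ys \<le> V xs ys then 1 else 0 :: real)" for xs ys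
  have P0: "0 \<le> P x" and P1: "sum P UNIV = 1" for x using P by (auto simp: pd_def)
  have p0: "0 \<le> p xs" for xs unfolding p_def by (intro prod_nonneg) (simp add: P0)
  have p1: "sum p (words n) = 1"
    unfolding p_def by (subst sum_words_prod) (simp add: P1)
  have V0: "0 \<le> V xs ys" for xs ys by (simp add: V_def W chan_pow_nonneg)
  have B0: "0 \<le> B ys" for ys unfolding B_def by (intro prod_nonneg) (simp add: tilted_nonneg P)
  have B: "(\<Sum>xs\<in>words n. p xs * V xs ys powr \<alpha>) = B ys" for ys
    unfolding p_def V_def chan_pow_def B_def tilted_def
    by (simp add: prod_powr_distrib prod.distrib[symmetric]
        sum_words_prod[of "\<lambda>i x. P x * W x (ys ! i) powr \<alpha>" n])
  have q0: "0 \<le> q ys" for ys by (simp add: q_def)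
  have qa: "q ys powr \<alpha> = real M * B ys" for ys
    using a B0 by (simp add: q_def powr_powr)
  \<comment> \<open>Markov's inequality: acceptance forces \<open>V xs ys powr \<alpha>\<close> to
    be at least \<open>M\<close> times its \<open>p\<close>-average \<open>B ys\<close>.\<close>
  have TM: "(\<Sum>xs\<in>words n. p xs * T xs ys) \<le> 1 / real M" for ys
  proof (cases "0 < B ys")
    case True
    have "(\<Sum>xs\<in>words n. p xs * T xs ys) \<le> (\<Sum>xs\<in>words n. p xs * V xs ys powr \<alpha> / (real M * B ys))"
    proof (rule sum_mono)
      fix xs
      show "p xs * T xs ys \<le> p xs * V xs ys powr \<alpha> / (real M * B ys)"
      proof (cases "q ys \<le> V xs ys")
        case le: True
        have "real M * B ys \<le> V xs ys powr \<alpha>"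
          using powr_mono2[of \<alpha> "q ys" "V xs ys"] le q0 a qa by simp
        then have "1 \<le> V xs ys powr \<alpha> / (real M * B ys)" using True M by simp
        from mult_left_mono[OF this p0[of xs]] le True show ?thesis by (simp add: T_def)
      qed (use p0 B0 in \<open>simp add: T_def\<close>)
    qed
    also have "\<dots> = 1 / real M" using True M by (simp add: sum_divide_distrib[symmetric] B)
    finally show ?thesis .
  qed (simp add: T_def)
  have err: "(\<Sum>xs\<in>words n. p xs * V xs ys * (1 - T xs ys))
      \<le> real M powr ((1 - \<alpha>) / \<alpha>) * B ys powr (1 / \<alpha>)" for ys
  proof -
    have "(\<Sum>xs\<in>words n. p xs * V xs ys * (1 - T xs ys))
      \<le> (\<Sum>xs\<in>words n. p xs * V xs ys powr \<alpha> * q ys powr (1 - \<alpha>))"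
    proof (rule sum_mono)
      fix xs :: "'x list" assume xs: "xs \<in> words n"
      show "p xs * V xs ys * (1 - T xs ys) \<le> p xs * V xs ys powr \<alpha> * q ys powr (1 - \<alpha>)"
      proof (cases "0 < B ys")
        case True
        show ?thesis
        proof (cases "q ys \<le> V xs ys")
          case False
          have "V xs ys = V xs ys powr \<alpha> * V xs ys powr (1 - \<alpha>)"
            using V0[of xs ys] by (simp add: powr_add[symmetric])
          also have "\<dots> \<le> V xs ys powr \<alpha> * q ys powr (1 - \<alpha>)"
            using False V0[of xs ys] a by (intro mult_left_mono powr_mono2) auto
          finally show ?thesis using False p0[of xs] by (simp add: T_def mult.assoc mult_left_mono)
        qed (use True p0 in \<open>simp add: T_def\<close>)
      next
        case False
        \<comment> \<open>All summands of \<open>B ys\<close> are nonnegative, hence zero, so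
          \<open>p xs\<close> or \<open>V xs ys\<close> vanishes and the rejected term costs
          nothing.\<close>
        then have "B ys = 0" using B0[of ys] by simp
        then have "p xs * V xs ys powr \<alpha> = 0"
          using B[of ys] xs p0
            sum_nonneg_eq_0_iff[OF finite_words, of n "\<lambda>xs. p xs * V xs ys powr \<alpha>"] by simp
        then show ?thesis by auto
      qed
    qed
    also have "\<dots> = B ys * q ys powr (1 - \<alpha>)" by (simp add: sum_distrib_right[symmetric] B)
    also have "\<dots> = real M powr ((1 - \<alpha>) / \<alpha>) * B ys powr (1 / \<alpha>)"
    proof -
      have "q ys powr (1 - \<alpha>) = real M powr ((1 - \<alpha>) / \<alpha>) * B ys powr ((1 - \<alpha>) / \<alpha>)"
        by (simp add: q_def powr_powr powr_mult)
      moreover have "B ys * B ys powr ((1 - \<alpha>) / \<alpha>) = B ys powr (1 + (1 - \<alpha>) / \<alpha>)"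
        using B0[of ys] by (simp add: powr_add)
      moreover have "1 + (1 - \<alpha>) / \<alpha> = 1 / \<alpha>" using a by (simp add: field_simps)
      ultimately show ?thesis by (simp add: algebra_simps)
    qed
    finally show ?thesis .
  qed
  obtain Z where Z: "NS_code (words n) (words n) M Z"
    and le: "NS_error (words n) (words n) V M Z
      \<le> (\<Sum>ys\<in>words n. \<Sum>xs\<in>words n. p xs * V xs ys * (1 - T xs ys))"
    by (rule NS_code_of_test[OF M, of "words n" "words n" V p T])
      (use W p0 p1 TM in \<open>auto simp: V_def chan_pow_nonneg sum_chan_pow T_def\<close>)
  have "eps_NS_n W M n \<le> NS_error (words n) (words n) V M Z"
    unfolding V_def using eps_NS_n_le_error[OF W _ Z] M by simp
  also note le
  also have "(\<Sum>ys\<in>words n. \<Sum>xs\<in>words n. p xs * V xs ys * (1 - T xs ys))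
      \<le> (\<Sum>ys\<in>words n. real M powr ((1 - \<alpha>) / \<alpha>) * B ys powr (1 / \<alpha>))"
    by (intro sum_mono err)
  also have "\<dots> = real M powr ((1 - \<alpha>) / \<alpha>) * tilted_sum \<alpha> P W ^ n"
    by (simp add: sum_distrib_left[symmetric] B_def prod_powr_distrib tilted_sum_def
        sum_words_prod[of "\<lambda>_ y. tilted \<alpha> P W y powr (1 / \<alpha>)" n])
  finally show ?thesis .
qed


section \<open>The sphere-packing exponent\<close>

text \<open>The powers of \<open>P x\<close> recombine to \<open>P x\<close>, so the sum over inputs
  collapses to \<open>tilted\<close>. Points outside the support of the joint law contribute zero
  because \<open>0 powr \<alpha>\<close> is zero.\<close>

lemma renyi_joint_prodd:
  assumes W: "is_channel W" and P: "pd P" and Q: "pd Q" and a: "0 < \<alpha>" "\<alpha> < 1"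
  defines "s \<equiv> (\<Sum>y\<in>UNIV. tilted \<alpha> P W y * Q y powr (1 - \<alpha>))"
  shows "renyi \<alpha> (joint P W) (prodd P Q) = (if s = 0 then \<infinity> else ereal (ln s / (\<alpha> - 1)))"
proof -
  have eq: "(P x * W x y) powr \<alpha> * (P x * Q y) powr (1 - \<alpha>) = P x * W x y powr \<alpha> * Q y powr (1 - \<alpha>)" for x y
  proof -
    have "P x powr \<alpha> * P x powr (1 - \<alpha>) = P x" using P by (simp add: powr_add[symmetric] pd_def)
    then show ?thesis by (simp add: powr_mult algebra_simps)
  qed
  have j0: "0 \<le> joint P W a" for a using P W by (auto simp: joint_def pd_def is_channel_def split: prod.split)
  have "(\<Sum>a\<in>{a. 0 < joint P W a}. joint P W a powr \<alpha> * prodd P Q a powr (1 - \<alpha>))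
      = (\<Sum>a\<in>UNIV. joint P W a powr \<alpha> * prodd P Q a powr (1 - \<alpha>))"
    using j0 by (intro sum.mono_neutral_left) (auto simp: order_less_le)
  also have "\<dots> = (\<Sum>x\<in>UNIV. \<Sum>y\<in>UNIV. P x * W x y powr \<alpha> * Q y powr (1 - \<alpha>))"
    unfolding UNIV_Times_UNIV[symmetric] sum.cartesian_product
    by (intro sum.cong) (auto simp: joint_def prodd_def eq)
  also have "\<dots> = s"
    unfolding s_def tilted_def by (subst sum.swap) (simp add: sum_distrib_right)
  finally show ?thesis using a by (simp add: renyi_def Let_def)
qed

text \<open>Hoelder's inequality with exponents 1/\<alpha> and 1/(1-\<alpha>), where the factor from
  \<open>Q\<close> has norm one. It is obtained by summing the weighted Young inequality after
  normalising by \<open>S\<close>.\<close>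

lemma tilted_sum_Holder:
  assumes W: "is_channel W" and P: "pd P" and Q: "pd Q" and a: "0 < \<alpha>" "\<alpha> < 1"
  shows "(\<Sum>y\<in>UNIV. tilted \<alpha> P W y * Q y powr (1 - \<alpha>)) \<le> tilted_sum \<alpha> P W powr \<alpha>"
proof -
  define S where "S = tilted_sum \<alpha> P W"
  have S: "0 < S" unfolding S_def using tilted_sum_pos[OF W P] .
  have S1: "(\<Sum>y\<in>UNIV. tilted \<alpha> P W y powr (1 / \<alpha>)) = S" by (simp add: S_def tilted_sum_def)
  have "tilted \<alpha> P W y * Q y powr (1 - \<alpha>)
      \<le> S powr \<alpha> * (\<alpha> * (tilted \<alpha> P W y powr (1 / \<alpha>) / S) + (1 - \<alpha>) * Q y)" for y
  proof (cases "tilted \<alpha> P W y = 0 \<or> Q y = 0")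
    case True
    then have "tilted \<alpha> P W y * Q y powr (1 - \<alpha>) = 0" by auto
    also have "0 \<le> S powr \<alpha> * (\<alpha> * (tilted \<alpha> P W y powr (1 / \<alpha>) / S) + (1 - \<alpha>) * Q y)"
      using a S Q by (intro mult_nonneg_nonneg add_nonneg_nonneg) (auto simp: pd_def)
    finally show ?thesis .
  next
    case False
    have B: "0 < tilted \<alpha> P W y" and Qy: "0 < Q y"
      using False tilted_nonneg[OF P, of \<alpha> W y] Q by (auto simp: pd_def order_less_le)
    have "(tilted \<alpha> P W y powr (1 / \<alpha>) / S) powr \<alpha> * Q y powr (1 - \<alpha>)
        \<le> \<alpha> * (tilted \<alpha> P W y powr (1 / \<alpha>) / S) + (1 - \<alpha>) * Q y"
      using a B Qy S by (intro Youngs_inequality_0) auto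
    moreover have "(tilted \<alpha> P W y powr (1 / \<alpha>) / S) powr \<alpha> = tilted \<alpha> P W y / S powr \<alpha>"
      using a B S by (simp add: powr_divide powr_powr)
    ultimately show ?thesis using S by (simp add: field_simps)
  qed
  then have "(\<Sum>y\<in>UNIV. tilted \<alpha> P W y * Q y powr (1 - \<alpha>))
    \<le> (\<Sum>y\<in>UNIV. S powr \<alpha> * (\<alpha> * (tilted \<alpha> P W y powr (1 / \<alpha>) / S) + (1 - \<alpha>) * Q y))"
    by (intro sum_mono)
  also have "\<dots> = S powr \<alpha> * (\<alpha> * ((\<Sum>y\<in>UNIV. tilted \<alpha> P W y powr (1 / \<alpha>)) / S) + (1 - \<alpha>) * sum Q UNIV)"
    by (simp add: sum_distrib_left[symmetric] sum.distrib sum_divide_distrib[symmetric])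
  also have "\<dots> = S powr \<alpha>" using S Q by (simp add: S1 pd_def)
  finally show ?thesis by (simp add: S_def)
qed

text \<open>Hoelder's inequality bounds every \<open>Q\<close>, with the direction reversed by the
  negative factor \<open>\<alpha> - 1\<close>; its equality case attains the bound.\<close>

lemma INF_renyi_eq:
  assumes W: "is_channel W" and P: "pd P" and a: "0 < \<alpha>" "\<alpha> < 1"
  shows "(INF Q\<in>{Q. pd Q}. ereal ((1 - \<alpha>) / \<alpha>) * (renyi \<alpha> (joint P W) (prodd P Q) - ereal r))
    = ereal (- ln (tilted_sum \<alpha> P W) - (1 - \<alpha>) / \<alpha> * r)"
proof (rule antisym)
  define S where "S = tilted_sum \<alpha> P W"
  have S: "0 < S" unfolding S_def using tilted_sum_pos[OF W P] .
  \<comment> \<open>The equality case of Hoelder's inequality, normalised to a distribution.\<close>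
  define Q where "Q y = tilted \<alpha> P W y powr (1 / \<alpha>) / S" for y
  have Q: "pd Q"
    using S by (auto simp: pd_def Q_def sum_divide_distrib[symmetric] S_def tilted_sum_def)
  have "(\<Sum>y\<in>UNIV. tilted \<alpha> P W y * Q y powr (1 - \<alpha>))
      = (\<Sum>y\<in>UNIV. tilted \<alpha> P W y powr (1 / \<alpha>) * S powr (\<alpha> - 1))"
  proof (rule sum.cong[OF refl])
    fix y
    have "tilted \<alpha> P W y * tilted \<alpha> P W y powr ((1 - \<alpha>) / \<alpha>) = tilted \<alpha> P W y powr (1 + (1 - \<alpha>) / \<alpha>)"
      using tilted_nonneg[OF P, of \<alpha> W y] by (simp add: powr_add)
    also have "1 + (1 - \<alpha>) / \<alpha> = 1 / \<alpha>" using a by (simp add: field_simps)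
    finally have e: "tilted \<alpha> P W y * tilted \<alpha> P W y powr ((1 - \<alpha>) / \<alpha>) = tilted \<alpha> P W y powr (1 / \<alpha>)" .
    have "Q y powr (1 - \<alpha>) = tilted \<alpha> P W y powr ((1 - \<alpha>) / \<alpha>) * S powr (\<alpha> - 1)"
      using S a by (simp add: Q_def powr_divide powr_powr powr_minus_divide[of S "1 - \<alpha>", simplified])
    with e show "tilted \<alpha> P W y * Q y powr (1 - \<alpha>) = tilted \<alpha> P W y powr (1 / \<alpha>) * S powr (\<alpha> - 1)"
      by (simp add: mult.assoc[symmetric])
  qed
  also have "\<dots> = S * S powr (\<alpha> - 1)" by (simp add: sum_distrib_right[symmetric] S_def tilted_sum_def)
  also have "\<dots> = S powr \<alpha>" using S by (simp add: powr_diff)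
  finally have "renyi \<alpha> (joint P W) (prodd P Q) = ereal (\<alpha> * ln S / (\<alpha> - 1))"
    using S by (simp add: renyi_joint_prodd[OF W P Q a] ln_powr)
  moreover have "(1 - \<alpha>) / \<alpha> * (\<alpha> * ln S / (\<alpha> - 1) - r) = - ln S - (1 - \<alpha>) / \<alpha> * r"
    using a by (simp add: divide_simps) (simp add: algebra_simps)
  ultimately have "ereal ((1 - \<alpha>) / \<alpha>) * (renyi \<alpha> (joint P W) (prodd P Q) - ereal r)
      = ereal (- ln S - (1 - \<alpha>) / \<alpha> * r)" by simp
  then show "(INF Q\<in>{Q. pd Q}. ereal ((1 - \<alpha>) / \<alpha>) * (renyi \<alpha> (joint P W) (prodd P Q) - ereal r))
    \<le> ereal (- ln S - (1 - \<alpha>) / \<alpha> * r)"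
    using Q by (metis (mono_tags, lifting) INF_lower mem_Collect_eq)
  show "ereal (- ln S - (1 - \<alpha>) / \<alpha> * r)
    \<le> (INF Q\<in>{Q. pd Q}. ereal ((1 - \<alpha>) / \<alpha>) * (renyi \<alpha> (joint P W) (prodd P Q) - ereal r))"
  proof (rule INF_greatest)
    fix Q :: "'b \<Rightarrow> real" assume "Q \<in> {Q. pd Q}"
    then have Q: "pd Q" by simp
    define s where "s = (\<Sum>y\<in>UNIV. tilted \<alpha> P W y * Q y powr (1 - \<alpha>))"
    note re = renyi_joint_prodd[OF W P Q a, folded s_def]
    have k: "0 < (1 - \<alpha>) / \<alpha>" using a by simp
    show "ereal (- ln S - (1 - \<alpha>) / \<alpha> * r) \<le> ereal ((1 - \<alpha>) / \<alpha>) * (renyi \<alpha> (joint P W) (prodd P Q) - ereal r)"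
    proof (cases "s = 0")
      case False
      have "0 \<le> s" unfolding s_def
        by (intro sum_nonneg mult_nonneg_nonneg tilted_nonneg[OF P]) auto
      then have s0: "0 < s" using False by simp
      have "ln s \<le> ln (S powr \<alpha>)"
        using tilted_sum_Holder[OF W P Q a] s0 S
        by (subst ln_le_cancel_iff) (auto simp: s_def S_def)
      then have "ln s \<le> \<alpha> * ln S" using S by (simp add: ln_powr)
      then have "- ln S \<le> - (ln s / \<alpha>)" using a by (simp add: field_simps)
      moreover have "(1 - \<alpha>) / \<alpha> * (ln s / (\<alpha> - 1) - r) = - (ln s / \<alpha>) - (1 - \<alpha>) / \<alpha> * r"
        using a by (simp add: divide_simps) (simp add: algebra_simps)
      ultimately show ?thesis using False by (simp add: re)
    qed (use a in \<open>simp add: re\<close>)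
  qed
qed

lemma E_sp_ge:
  assumes W: "is_channel W" and P: "pd P" and a: "0 < \<alpha>" "\<alpha> < 1"
  shows "ereal (- ln (tilted_sum \<alpha> P W) - (1 - \<alpha>) / \<alpha> * r) \<le> E_sp W r"
  unfolding E_sp_def
  by (rule SUP_upper2[of \<alpha>]) (use assms in \<open>auto simp: INF_renyi_eq[OF W _ a] intro!: SUP_upper\<close>)

lemma E_sp_le:
  assumes W: "is_channel W" and C: "0 \<le> C"
    and le: "\<And>P \<alpha>. pd P \<Longrightarrow> 0 < \<alpha> \<Longrightarrow> \<alpha> < 1 \<Longrightarrow> ereal (- ln (tilted_sum \<alpha> P W) - (1 - \<alpha>) / \<alpha> * r) \<le> C"
  shows "E_sp W r \<le> C"
  unfolding E_sp_def
proof (rule SUP_least)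
  fix \<alpha> :: real assume \<alpha>: "\<alpha> \<in> {0<..1}"
  show "(if \<alpha> = 1 then 0 else SUP P\<in>{P. pd P}. INF Q\<in>{Q. pd Q}.
      ereal ((1 - \<alpha>) / \<alpha>) * (renyi \<alpha> (joint P W) (prodd P Q) - ereal r)) \<le> C"
  proof (cases "\<alpha> = 1")
    case False
    then have "0 < \<alpha>" "\<alpha> < 1" using \<alpha> by auto
    then show ?thesis using le by (simp add: INF_renyi_eq[OF W] SUP_le_iff)
  qed (use C in simp)
qed

section \<open>Sphere-packing lower bound on the error rates\<close>

lemma rate_ge:
  assumes "0 < n" "0 < b" "e \<le> b"
  shows "ereal (- ln b / real n) \<le> rate n e"
  using assms by (auto simp: rate_def intro!: divide_right_mono)

text \<open>Stated for a sequence \<open>M n\<close> so as to cover both a fixed number of messages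
  and exponentially many. The constant \<open>C\<close> disappears after division by
  \<open>n\<close>. The size \<open>2\<close> is demanded only for positive \<open>n\<close>, since
  at \<open>n = 0\<close> the ceiling of the exponential is \<open>1\<close>.\<close>

lemma E_sp_le_Liminf_rate:
  fixes W :: "'x::finite \<Rightarrow> 'y::finite \<Rightarrow> real"
  assumes W: "is_channel W" and M: "\<And>n. 0 < n \<Longrightarrow> 2 \<le> M n"
    and C: "0 < C" and MC: "\<And>n. real (M n) \<le> C * exp (r * real n)"
  shows "E_sp W r \<le> Liminf sequentially (\<lambda>n. rate n (eps_NS_n W (M n) n))"
proof (rule E_sp_le[OF W])
  have "eventually (\<lambda>n. 0 \<le> rate n (eps_NS_n W (M n) n)) sequentially"
    using eventually_gt_at_top[of 0]
  proof eventually_elim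
    case (elim n)
    then show ?case using rate_ge[of n 1] eps_NS_n_le_1[OF W M, of n n] by (simp add: zero_ereal_def)
  qed
  then show "0 \<le> Liminf sequentially (\<lambda>n. rate n (eps_NS_n W (M n) n))"
    by (rule Liminf_bounded)
next
  fix P :: "'x \<Rightarrow> real" and \<alpha> :: real
  assume P: "pd P" and a: "0 < \<alpha>" "\<alpha> < 1"
  define S where "S = tilted_sum \<alpha> P W"
  define k where "k = (1 - \<alpha>) / \<alpha>"
  have S: "0 < S" unfolding S_def using tilted_sum_pos[OF W P] .
  have k: "0 < k" using a by (simp add: k_def)
  have "eventually (\<lambda>n. ereal (- ln S - k * r - k * ln C / real n) \<le> rate n (eps_NS_n W (M n) n)) sequentially"
    using eventually_gt_at_top[of 0]
  proof eventually_elim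
    case (elim n)
    have "eps_NS_n W (M n) n \<le> real (M n) powr k * S ^ n"
      using eps_NS_n_le_tilted_sum[OF W P a M[OF elim]] by (simp add: k_def S_def)
    also have "\<dots> \<le> (C * exp (r * real n)) powr k * S ^ n"
      using MC k S by (intro mult_right_mono powr_mono2) auto
    finally have "ereal (- ln ((C * exp (r * real n)) powr k * S ^ n) / real n) \<le> rate n (eps_NS_n W (M n) n)"
      using elim C S by (intro rate_ge) auto
    moreover have "- ln ((C * exp (r * real n)) powr k * S ^ n) / real n = - ln S - k * r - k * ln C / real n"
      using elim C S by (simp add: ln_mult ln_powr ln_realpow field_simps)
    ultimately show ?case by simp
  qed
  then have "Liminf sequentially (\<lambda>n. ereal (- ln S - k * r - k * ln C / real n))
      \<le> Liminf sequentially (\<lambda>n. rate n (eps_NS_n W (M n) n))" by (rule Liminf_mono)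
  moreover have "((\<lambda>n. - ln S - k * r - k * ln C / real n) \<longlongrightarrow> - ln S - k * r - 0) sequentially"
    by (intro tendsto_intros lim_const_over_n)
  then have "Liminf sequentially (\<lambda>n. ereal (- ln S - k * r - k * ln C / real n)) = ereal (- ln S - k * r - 0)"
    by (intro lim_imp_Liminf) auto
  ultimately show "ereal (- ln (tilted_sum \<alpha> P W) - (1 - \<alpha>) / \<alpha> * r)
      \<le> Liminf sequentially (\<lambda>n. rate n (eps_NS_n W (M n) n))" by (simp add: S_def k_def)
qed


section \<open>The sphere-packing exponent at rate zero\<close>

text \<open>The case distinction is needed because ln 0 = 0.\<close>

definition geo :: "('x::finite \<Rightarrow> real) \<Rightarrow> ('x \<Rightarrow> 'y \<Rightarrow> real) \<Rightarrow> 'y \<Rightarrow> real" where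
  "geo P W y = (if \<exists>x. 0 < P x \<and> W x y = 0 then 0 else exp (\<Sum>x\<in>UNIV. P x * ln (W x y)))"

lemma channel_le_1: "is_channel W \<Longrightarrow> W x y \<le> 1"
  unfolding is_channel_def using member_le_sum[of y UNIV "W x"] by auto

lemma tendsto_powr_inverse_at_right_0:
  fixes c :: real assumes c: "0 < c" "c < 1"
  shows "((\<lambda>\<alpha>. c powr (1 / \<alpha>)) \<longlongrightarrow> 0) (at_right 0)"
proof -
  have "filterlim (\<lambda>\<alpha>. ln c * inverse \<alpha>) at_bot (at_right 0)"
    using c by (intro filterlim_tendsto_neg_mult_at_bot[OF tendsto_const _ filterlim_inverse_at_top_right]) auto
  from filterlim_compose[OF exp_at_bot this] show ?thesis
    using c by (simp add: powr_def field_simps)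
qed

text \<open>Power means tend to the weighted geometric mean as the exponent tends to zero. If a zero
  entry carries weight, \<open>tilted\<close> stays below a constant less than one, which the power
  1/\<alpha> sends to zero. Otherwise the logarithm is a difference quotient at zero.\<close>

lemma tilted_powr_tendsto_geo:
  assumes W: "is_channel W" and P: "pd P"
  shows "((\<lambda>\<alpha>. tilted \<alpha> P W y powr (1 / \<alpha>)) \<longlongrightarrow> geo P W y) (at_right 0)"
proof (cases "\<exists>x. 0 < P x \<and> W x y = 0")
  case True
  then obtain x0 where x0: "0 < P x0" "W x0 y = 0" by blast
  have P0: "0 \<le> P x" and P1: "sum P UNIV = 1" for x using P by (auto simp: pd_def)
  have Px: "P x0 \<le> 1" using member_le_sum[of x0 UNIV P] P0 P1 by auto
  \<comment> \<open>The mass outside \<open>x0\<close> is \<open>1 - P x0\<close>, possibly zero;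
    halving keeps \<open>c\<close> strictly between zero and one.\<close>
  define c where "c = 1 - P x0 / 2"
  have c: "0 < c" "c < 1" using x0 Px by (auto simp: c_def)
  have le: "tilted \<alpha> P W y \<le> c" if "0 < \<alpha>" for \<alpha>
  proof -
    have "tilted \<alpha> P W y = (\<Sum>x\<in>UNIV - {x0}. P x * W x y powr \<alpha>)"
      using x0 unfolding tilted_def by (subst sum.remove[of _ x0]) auto
    also have "\<dots> \<le> (\<Sum>x\<in>UNIV - {x0}. P x * 1)"
      using W P0 channel_le_1[OF W] that
      by (intro sum_mono mult_left_mono) (auto simp: is_channel_def intro!: powr_le1)
    also have "\<dots> = 1 - P x0" using P1 by (simp add: sum_diff1)
    finally show ?thesis using x0 by (simp add: c_def)
  qed
  have "((\<lambda>\<alpha>. tilted \<alpha> P W y powr (1 / \<alpha>)) \<longlongrightarrow> 0) (at_right 0)"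
  proof (rule tendsto_sandwich[OF _ _ tendsto_const tendsto_powr_inverse_at_right_0[OF c]])
    show "\<forall>\<^sub>F \<alpha> in at_right 0. tilted \<alpha> P W y powr (1 / \<alpha>) \<le> c powr (1 / \<alpha>)"
      using eventually_at_right_less[of 0]
      by eventually_elim (use le tilted_nonneg[OF P, of _ W y] in \<open>auto intro!: powr_mono2\<close>)
  qed auto
  then show ?thesis using True by (simp add: geo_def)
next
  case False
  have P0: "0 \<le> P x" and P1: "sum P UNIV = 1" for x using P by (auto simp: pd_def)
  \<comment> \<open>The exponential form is differentiable at zero; it agrees with
    \<open>tilted\<close> because entries \<open>W x y = 0\<close> now have
    \<open>P x = 0\<close>.\<close>
  define h where "h \<alpha> = (\<Sum>x\<in>UNIV. P x * exp (\<alpha> * ln (W x y)))" for \<alpha>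
  have h: "tilted \<alpha> P W y = h \<alpha>" for \<alpha>
    unfolding tilted_def h_def
  proof (rule sum.cong[OF refl])
    fix x show "P x * W x y powr \<alpha> = P x * exp (\<alpha> * ln (W x y))"
      using False P0[of x] by (cases "P x = 0") (auto simp: powr_def order_less_le)
  qed
  have h0: "h 0 = 1" by (simp add: h_def P1)
  have "(h has_real_derivative (\<Sum>x\<in>UNIV. P x * ln (W x y))) (at 0)"
    unfolding h_def by (auto intro!: derivative_eq_intros simp: mult.commute)
  then have "((\<lambda>\<alpha>. ln (h \<alpha>)) has_real_derivative (\<Sum>x\<in>UNIV. P x * ln (W x y))) (at 0)"
    using h0 by (auto intro!: derivative_eq_intros)
  then have "((\<lambda>\<alpha>. ln (h \<alpha>) / \<alpha>) \<longlongrightarrow> (\<Sum>x\<in>UNIV. P x * ln (W x y))) (at 0)"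
    by (simp add: DERIV_def h0)
  then have "((\<lambda>\<alpha>. ln (h \<alpha>) / \<alpha>) \<longlongrightarrow> (\<Sum>x\<in>UNIV. P x * ln (W x y))) (at_right 0)"
    by (rule filterlim_mono) (auto simp: at_le)
  from tendsto_exp[OF this]
  have "((\<lambda>\<alpha>. exp (ln (h \<alpha>) / \<alpha>)) \<longlongrightarrow> geo P W y) (at_right 0)"
    unfolding geo_def using False by (simp only: if_False)
  moreover have "tilted \<alpha> P W y powr (1 / \<alpha>) = exp (ln (h \<alpha>) / \<alpha>)" for \<alpha>
  proof -
    have "\<exists>x. P x \<noteq> 0" using P1 by (metis sum.neutral zero_neq_one)
    then obtain x where "P x \<noteq> 0" by blast
    then have "0 < h \<alpha>" using P0 unfolding h_def
      by (intro sum_pos2[of _ x]) (auto simp: order_less_le)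
    then show ?thesis by (simp add: h powr_def)
  qed
  ultimately show ?thesis by simp
qed

text \<open>\<open>P x\<close> cancels in the likelihood ratio. Wherever the convention
  \<open>ln 0 = 0\<close> is met, the term carries a factor zero.\<close>

lemma KL_prodd_joint:
  assumes W: "is_channel W" and P: "pd P" and Q: "pd Q"
    and nz: "\<And>x y. 0 < P x \<Longrightarrow> 0 < Q y \<Longrightarrow> W x y \<noteq> 0"
  shows "KL (prodd P Q) (joint P W) = ereal (\<Sum>y\<in>UNIV. Q y * (ln (Q y) - (\<Sum>x\<in>UNIV. P x * ln (W x y))))"
proof -
  have P0: "0 \<le> P x" and P1: "sum P UNIV = 1" for x using P by (auto simp: pd_def)
  have Q0: "0 \<le> Q y" for y using Q by (auto simp: pd_def)
  have nb: "\<not> (\<exists>a. 0 < prodd P Q a \<and> joint P W a = 0)"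
  proof clarify
    fix x y assume "0 < prodd P Q (x, y)" "joint P W (x, y) = 0"
    then show False using P0[of x] Q0[of y] nz[of x y]
      by (auto simp: prodd_def joint_def zero_less_mult_iff)
  qed
  have pp: "0 \<le> prodd P Q a" for a using P0 Q0 by (auto simp: prodd_def split: prod.split)
  have "(\<Sum>a\<in>{a. 0 < prodd P Q a}. prodd P Q a * ln (prodd P Q a / joint P W a))
      = (\<Sum>a\<in>UNIV. prodd P Q a * ln (prodd P Q a / joint P W a))"
    using pp by (intro sum.mono_neutral_left) (auto simp: order_less_le)
  also have "\<dots> = (\<Sum>x\<in>UNIV. \<Sum>y\<in>UNIV. P x * Q y * (ln (Q y) - ln (W x y)))"
    unfolding UNIV_Times_UNIV[symmetric] sum.cartesian_product
  proof (intro sum.cong refl, clarify)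
    fix x y
    show "prodd P Q (x, y) * ln (prodd P Q (x, y) / joint P W (x, y)) = P x * Q y * (ln (Q y) - ln (W x y))"
    proof (cases "P x = 0 \<or> Q y = 0")
      case False
      then have "0 < P x" "0 < Q y" using P0[of x] Q0[of y] by auto
      moreover from this have "0 < W x y" using nz[of x y] W by (auto simp: is_channel_def order_less_le)
      ultimately show ?thesis by (simp add: prodd_def joint_def ln_div)
    qed (auto simp: prodd_def)
  qed
  also have "\<dots> = (\<Sum>y\<in>UNIV. Q y * (ln (Q y) - (\<Sum>x\<in>UNIV. P x * ln (W x y))))"
  proof (subst sum.swap, intro sum.cong refl)
    fix y
    have "(\<Sum>x\<in>UNIV. P x * Q y * (ln (Q y) - ln (W x y)))
        = (\<Sum>x\<in>UNIV. P x * (Q y * ln (Q y)) - Q y * (P x * ln (W x y)))"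
      by (intro sum.cong) (auto simp: algebra_simps)
    also have "\<dots> = Q y * ln (Q y) - Q y * (\<Sum>x\<in>UNIV. P x * ln (W x y))"
      by (simp add: sum_subtractf sum_distrib_right[symmetric] sum_distrib_left[symmetric] P1)
    finally show "(\<Sum>x\<in>UNIV. P x * Q y * (ln (Q y) - ln (W x y)))
        = Q y * (ln (Q y) - (\<Sum>x\<in>UNIV. P x * ln (W x y)))" by (simp add: algebra_simps)
  qed
  finally show ?thesis using nb by (simp add: KL_def)
qed

text \<open>The normalised geometric mean is a candidate \<open>Q\<close> of divergence
  \<open>- ln G\<close>, which exceeds \<open>c\<close>. If \<open>G\<close> is zero the bound is
  trivial. Taking \<open>c\<close> strictly below the infimum also covers an infinite
  infimum.\<close>

lemma sum_geo_less:
  fixes W :: "'x::finite \<Rightarrow> 'y::finite \<Rightarrow> real"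
  assumes W: "is_channel W" and P: "pd P"
    and c: "ereal c < (INF Q\<in>{Q. pd Q}. KL (prodd P Q) (joint P W))"
  shows "(\<Sum>y\<in>UNIV. geo P W y) < exp (- c)"
proof -
  define G where "G = (\<Sum>y\<in>UNIV. geo P W y)"
  have g0: "0 \<le> geo P W y" for y by (simp add: geo_def)
  have "0 \<le> G" unfolding G_def using g0 by (intro sum_nonneg) auto
  then consider "G = 0" | "0 < G" by linarith
  then have "G < exp (- c)"
  proof cases
    case 2
    define Q where "Q y = geo P W y / G" for y
    have Q: "pd Q" using 2 g0 by (auto simp: pd_def Q_def sum_divide_distrib[symmetric] G_def)
    have nz: "W x y \<noteq> 0" if "0 < P x" "0 < Q y" for x y
      using that 2 by (auto simp: Q_def geo_def zero_less_divide_iff split: if_splits)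
    have "Q y * (ln (Q y) - (\<Sum>x\<in>UNIV. P x * ln (W x y))) = Q y * (- ln G)" for y
    proof (cases "Q y = 0")
      case False
      then have "geo P W y = exp (\<Sum>x\<in>UNIV. P x * ln (W x y))"
        by (auto simp: Q_def geo_def split: if_splits)
      then show ?thesis using 2 by (simp add: Q_def ln_div)
    qed simp
    then have "KL (prodd P Q) (joint P W) = ereal (- ln G)"
      using Q by (simp add: KL_prodd_joint[OF W P Q nz] sum_distrib_right[symmetric] sum_negf pd_def)
    then have "ereal c < ereal (- ln G)"
      using c Q by (metis (mono_tags, lifting) INF_lower mem_Collect_eq order_less_le_trans)
    then have "exp (ln G) < exp (- c)" by simp
    then show ?thesis using 2 by simp
  qed simp
  then show ?thesis by (simp add: G_def)
qed

text \<open>For fixed \<open>P\<close> and \<open>c\<close> below its value, a small \<alpha> is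
  fixed first; at that \<alpha> the penalty linear in \<open>r\<close> vanishes as \<open>r\<close>
  tends to zero.\<close>

lemma umlaut_le_Liminf_E_sp:
  fixes W :: "'x::finite \<Rightarrow> 'y::finite \<Rightarrow> real"
  assumes W: "is_channel W"
  shows "umlaut W \<le> Liminf (at_right 0) (E_sp W)"
  unfolding umlaut_def
proof (rule SUP_least)
  fix P :: "'x \<Rightarrow> real" assume "P \<in> {P. pd P}"
  then have P: "pd P" by simp
  show "(INF Q\<in>{Q. pd Q}. KL (prodd P Q) (joint P W)) \<le> Liminf (at_right 0) (E_sp W)"
    unfolding le_Liminf_iff
  proof (intro allI impI)
    fix z assume "z < (INF Q\<in>{Q. pd Q}. KL (prodd P Q) (joint P W))"
    then obtain c where c: "z < ereal c" "ereal c < (INF Q\<in>{Q. pd Q}. KL (prodd P Q) (joint P W))"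
      using ereal_dense2 by blast
    have "((\<lambda>\<alpha>. tilted_sum \<alpha> P W) \<longlongrightarrow> (\<Sum>y\<in>UNIV. geo P W y)) (at_right 0)"
      unfolding tilted_sum_def by (intro tendsto_sum tilted_powr_tendsto_geo W P)
    then have "\<forall>\<^sub>F \<alpha> in at_right 0. tilted_sum \<alpha> P W < exp (- c)"
      using sum_geo_less[OF W P c(2)] by (rule order_tendstoD)
    then have "\<forall>\<^sub>F \<alpha> in at_right 0. tilted_sum \<alpha> P W < exp (- c) \<and> 0 < \<alpha> \<and> \<alpha> < (1::real)"
      by (intro eventually_conj eventually_at_right_less)
        (auto simp: eventually_at_right_field intro!: exI[of _ 1])
    then obtain \<alpha> where \<alpha>: "tilted_sum \<alpha> P W < exp (- c)" "0 < \<alpha>" "\<alpha> < (1::real)"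
      using eventually_happens'[OF trivial_limit_at_right_real] by blast
    define k where "k = (1 - \<alpha>) / \<alpha>"
    have "ln (tilted_sum \<alpha> P W) < ln (exp (- c))"
      using \<alpha>(1) tilted_sum_pos[OF W P, of \<alpha>] by (subst ln_less_cancel_iff) auto
    then have "c < - ln (tilted_sum \<alpha> P W) - k * 0" by simp
    moreover have "((\<lambda>r. - ln (tilted_sum \<alpha> P W) - k * r) \<longlongrightarrow> - ln (tilted_sum \<alpha> P W) - k * 0) (at_right 0)"
      by (intro tendsto_intros)
    ultimately have "\<forall>\<^sub>F r in at_right 0. c < - ln (tilted_sum \<alpha> P W) - k * r"
      using order_tendstoD(1) by blast
    then show "\<forall>\<^sub>F r in at_right 0. z < E_sp W r"
    proof eventually_elim
      case (elim r)
      have "z < ereal (- ln (tilted_sum \<alpha> P W) - k * r)"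
        using c(1) elim by (meson less_ereal.simps(1) order_less_trans)
      also have "\<dots> \<le> E_sp W r" unfolding k_def by (rule E_sp_ge[OF W P \<alpha>(2,3)])
      finally show ?case .
    qed
  qed
qed


section \<open>Converse\<close>

text \<open>Nonnegativity of the relative entropy of \<open>Q\<close> with respect to the normalised
  weights \<open>exp (a y) / G\<close> on \<open>A\<close>, from ln t \<le> t - 1.\<close>

lemma Gibbs_variational:
  fixes Q :: "'y::finite \<Rightarrow> real"
  assumes Q: "pd Q" and A: "\<And>y. 0 < Q y \<Longrightarrow> y \<in> A" and ne: "A \<noteq> {}"
  shows "- ln (\<Sum>y\<in>A. exp (a y)) \<le> (\<Sum>y\<in>UNIV. Q y * (ln (Q y) - a y))"
proof -
  define G where "G = (\<Sum>y\<in>A. exp (a y))"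
  have G: "0 < G" unfolding G_def using ne by (intro sum_pos) auto
  have Q0: "0 \<le> Q y" for y using Q by (auto simp: pd_def)
  have Qout: "Q y = 0" if "y \<notin> A" for y using A[of y] Q0[of y] that by fastforce
  have le: "Q y * (a y - ln G - ln (Q y)) \<le> exp (a y) / G - Q y" for y
  proof (cases "Q y = 0")
    case False
    then have q: "0 < Q y" using Q0[of y] by simp
    have "ln (exp (a y) / (G * Q y)) \<le> exp (a y) / (G * Q y) - 1"
      using q G by (intro ln_le_minus_one) auto
    then have "a y - ln G - ln (Q y) \<le> exp (a y) / (G * Q y) - 1"
      using q G by (simp add: ln_div ln_mult)
    from mult_left_mono[OF this Q0[of y]] show ?thesis using q by (simp add: field_simps)
  qed (use G in simp)
  have QA: "sum Q A = 1" using Q Qout by (subst sum.mono_neutral_left[of UNIV A Q]) (auto simp: pd_def)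
  have "(\<Sum>y\<in>A. Q y * (a y - ln G - ln (Q y))) \<le> (\<Sum>y\<in>A. exp (a y) / G - Q y)"
    by (intro sum_mono le)
  also have "\<dots> = 0" using G QA by (simp add: sum_subtractf sum_divide_distrib[symmetric] G_def)
  finally have "(\<Sum>y\<in>A. Q y * (a y - ln G - ln (Q y))) \<le> 0" .
  moreover have "(\<Sum>y\<in>A. Q y * (a y - ln G - ln (Q y)))
      = - ln G * sum Q A - (\<Sum>y\<in>A. Q y * (ln (Q y) - a y))"
    by (simp add: sum_subtractf[symmetric] sum_distrib_left algebra_simps)
  moreover have "(\<Sum>y\<in>A. Q y * (ln (Q y) - a y)) = (\<Sum>y\<in>UNIV. Q y * (ln (Q y) - a y))"
    using Qout by (intro sum.mono_neutral_left) auto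
  ultimately show ?thesis using QA by (simp add: G_def)
qed

text \<open>A closed subset of the unit cube in the product topology; it provides the minimiser in
  the converse.\<close>

lemma compact_pd: "compact {P :: 'a::finite \<Rightarrow> real. pd P}"
proof -
  have "closed {P :: 'a \<Rightarrow> real. (\<forall>a. 0 \<le> P a) \<and> sum P UNIV = 1}"
    by (intro closed_Collect_conj closed_Collect_all closed_Collect_le closed_Collect_eq
        continuous_intros continuous_on_product_coordinates)
  moreover have "compact (PiE UNIV (\<lambda>_::'a. {0..1::real}))"
    using compactin_PiE[of "\<lambda>_::'a. euclidean :: real topology" UNIV "\<lambda>_. {0..1}"]
    by (simp add: euclidean_product_topology)
  ultimately have "compact (PiE UNIV (\<lambda>_::'a. {0..1::real}) \<inter> {P. (\<forall>a. 0 \<le> P a) \<and> sum P UNIV = 1})"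
    by (intro compact_Int_closed)
  moreover have "P a \<le> 1" if "\<forall>a. 0 \<le> P a" "sum P UNIV = 1" for P :: "'a \<Rightarrow> real" and a
    using member_le_sum[of a UNIV P] that by auto
  then have "PiE UNIV (\<lambda>_::'a. {0..1::real}) \<inter> {P. (\<forall>a. 0 \<le> P a) \<and> sum P UNIV = 1} = {P. pd P}"
    by (auto simp: pd_def PiE_def)
  ultimately show ?thesis by simp
qed

lemma pd_mix:
  assumes "pd P" "pd R" "0 \<le> s" "s \<le> 1"
  shows "pd (\<lambda>x. (1 - s) * P x + s * R x)"
  using assms by (auto simp: pd_def sum.distrib sum_distrib_left[symmetric])

lemma pd_uniform: "pd (\<lambda>_::'a::finite. 1 / real CARD('a))"
  by (simp add: pd_def)

text \<open>Against the uniform input, every \<open>Q\<close> charges an output that some input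
  cannot produce. Hence a finite value forces an output reachable from all inputs.\<close>

lemma umlaut_eq_infinity:
  fixes W :: "'x::finite \<Rightarrow> 'y::finite \<Rightarrow> real"
  assumes "\<And>y. \<exists>x. W x y = 0"
  shows "umlaut W = \<infinity>"
proof -
  define P :: "'x \<Rightarrow> real" where "P = (\<lambda>_. 1 / real CARD('x))"
  have "KL (prodd P Q) (joint P W) = \<infinity>" if Q: "pd Q" for Q
  proof -
    have "\<exists>y. Q y \<noteq> 0" using Q unfolding pd_def by (metis sum.neutral zero_neq_one)
    then obtain y where "Q y \<noteq> 0" by blast
    then have y: "0 < Q y" using Q by (auto simp: pd_def order_less_le)
    obtain x where x: "W x y = 0" using assms by blast
    have "0 < prodd P Q (x, y) \<and> joint P W (x, y) = 0"
      using x y by (simp add: prodd_def joint_def P_def)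
    then show ?thesis unfolding KL_def by auto
  qed
  then have "\<infinity> \<le> (INF Q\<in>{Q. pd Q}. KL (prodd P Q) (joint P W))"
    by (intro INF_greatest) auto
  also have "\<dots> \<le> umlaut W"
    unfolding umlaut_def P_def using pd_uniform by (intro SUP_upper) auto
  finally show ?thesis by simp
qed

text \<open>With full support of \<open>P\<close>, a \<open>Q\<close> charging an output outside the
  set has infinite divergence, and all others obey the Gibbs bound.\<close>

lemma ln_le_umlaut:
  fixes W :: "'x::finite \<Rightarrow> 'y::finite \<Rightarrow> real"
  assumes W: "is_channel W" and ne: "{y. \<forall>x. W x y \<noteq> 0} \<noteq> {}" and P: "pd P" and pos: "\<And>x. 0 < P x"
  shows "ereal (- ln (\<Sum>y\<in>{y. \<forall>x. W x y \<noteq> 0}. exp (\<Sum>x\<in>UNIV. P x * ln (W x y)))) \<le> umlaut W"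
proof -
  let ?A = "{y. \<forall>x. W x y \<noteq> 0}"
  let ?c = "- ln (\<Sum>y\<in>?A. exp (\<Sum>x\<in>UNIV. P x * ln (W x y)))"
  have "ereal ?c \<le> KL (prodd P Q) (joint P W)" if Q: "pd Q" for Q
  proof (cases "\<forall>y. 0 < Q y \<longrightarrow> y \<in> ?A")
    case True
    then show ?thesis
      using Gibbs_variational[OF Q _ ne, of "\<lambda>y. \<Sum>x\<in>UNIV. P x * ln (W x y)"]
      by (simp add: KL_prodd_joint[OF W P Q])
  next
    case False
    then obtain x y where "0 < Q y" "W x y = 0" by blast
    then have "0 < prodd P Q (x, y) \<and> joint P W (x, y) = 0"
      using pos by (simp add: prodd_def joint_def)
    then show ?thesis unfolding KL_def by auto
  qed
  then have "ereal ?c \<le> (INF Q\<in>{Q. pd Q}. KL (prodd P Q) (joint P W))"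
    by (intro INF_greatest) auto
  also have "\<dots> \<le> umlaut W" unfolding umlaut_def using P by (intro SUP_upper) auto
  finally show ?thesis .
qed

lemma umlaut_saddle_output:
  fixes W :: "'x::finite \<Rightarrow> 'y::finite \<Rightarrow> real"
  assumes W: "is_channel W" and ne: "{y. \<forall>x. W x y \<noteq> 0} \<noteq> {}"
  obtains Q u where "pd Q" and "ereal u \<le> umlaut W"
    and "\<And>x y. 0 < Q y \<Longrightarrow> W x y \<noteq> 0"
    and "\<And>x. (\<Sum>y\<in>UNIV. Q y * (ln (Q y) - ln (W x y))) \<le> u"
proof -
  define A where "A = {y. \<forall>x. W x y \<noteq> 0}"
  define a where "a P y = (\<Sum>x\<in>UNIV. P x * ln (W x y))" for P y
  define F where "F P = (\<Sum>y\<in>A. exp (a P y))" for P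
  have ne: "A \<noteq> {}" using ne by (simp add: A_def)
  have Fpos: "0 < F P" for P unfolding F_def using ne by (intro sum_pos) auto
  have "continuous_on {P. pd P} F"
    unfolding F_def a_def
    by (intro continuous_intros continuous_on_subset[OF continuous_on_product_coordinates]) auto
  moreover have "{P :: 'x \<Rightarrow> real. pd P} \<noteq> {}" using pd_uniform by blast
  ultimately obtain P where P: "pd P" and min: "\<And>R. pd R \<Longrightarrow> F P \<le> F R"
    using continuous_attains_inf[OF compact_pd, of F] by blast
  define u where "u = - ln (F P)"
  \<comment> \<open>Each exponent is affine along a segment of the simplex, which makes the
    directional derivative of \<open>F\<close> explicit.\<close>
  have a_mix: "a (\<lambda>x. (1 - s) * P x + s * R x) y = a P y + s * (a R y - a P y)" for s R y
    by (simp add: a_def algebra_simps sum.distrib sum_subtractf sum_distrib_left)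
  have F_mix: "((\<lambda>s. F (\<lambda>x. (1 - s) * P x + s * R x)) has_real_derivative
      (\<Sum>y\<in>A. exp (a P y) * (a R y - a P y))) (at 0)" for R
    unfolding F_def a_mix by (auto intro!: derivative_eq_intros)
  \<comment> \<open>Stationarity at P in the directions of the simplex; at a vertex R it bounds D(Q || W(.|x)).\<close>
  have KKT: "0 \<le> (\<Sum>y\<in>A. exp (a P y) * (a R y - a P y))" if R: "pd R" for R
  proof (rule ccontr)
    assume "\<not> ?thesis"
    then have "(\<Sum>y\<in>A. exp (a P y) * (a R y - a P y)) < 0" by simp
    from DERIV_neg_dec_right[OF F_mix this] obtain d where d: "0 < d"
      and dec: "\<And>h. 0 < h \<Longrightarrow> h < d \<Longrightarrow> F (\<lambda>x. (1 - h) * P x + h * R x) < F P" by auto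
    define h where "h = min (d / 2) 1"
    have h: "0 < h" "h < d" "h \<le> 1" using d by (auto simp: h_def min_def)
    show False using dec[OF h(1,2)] min[OF pd_mix[OF P R, of h]] h by simp
  qed
  define Q where "Q y = (if y \<in> A then exp (a P y) / F P else 0)" for y
  have "sum Q UNIV = (\<Sum>y\<in>A. exp (a P y) / F P)"
    unfolding Q_def by (simp add: sum.If_cases)
  also have "\<dots> = 1" using Fpos[of P] by (simp add: sum_divide_distrib[symmetric] F_def)
  finally have Q: "pd Q" using Fpos[of P] by (auto simp: pd_def Q_def)
  have Qx: "(\<Sum>y\<in>UNIV. Q y * (ln (Q y) - ln (W x y))) \<le> u" for x
  proof -
    define R where "R x' = (if x' = x then 1 else 0 :: real)" for x'
    have R: "pd R" by (auto simp: pd_def R_def)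
    have aR: "a R y = ln (W x y)" for y 
      unfolding a_def R_def by (subst sum.mono_neutral_right[of UNIV "{x}"]) auto
    have "(\<Sum>y\<in>UNIV. Q y * (ln (Q y) - ln (W x y))) = (\<Sum>y\<in>A. Q y * (ln (Q y) - ln (W x y)))"
      by (intro sum.mono_neutral_right) (auto simp: Q_def)
    \<comment> \<open>On \<open>A\<close>, \<open>ln (Q y)\<close> equals \<open>a P y + u\<close>,
      while \<open>ln (W x y)\<close> is \<open>a R y\<close>.\<close>
    also have "\<dots> = (\<Sum>y\<in>A. Q y * u - exp (a P y) * (a R y - a P y) / F P)"
      using Fpos[of P] by (intro sum.cong) (auto simp: Q_def ln_div aR u_def field_simps)
    also have "\<dots> = sum Q A * u - (\<Sum>y\<in>A. exp (a P y) * (a R y - a P y)) / F P"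
      by (simp add: sum_subtractf sum_distrib_right sum_divide_distrib)
    also have "sum Q A = sum Q UNIV" by (intro sum.mono_neutral_left) (auto simp: Q_def)
    also have "sum Q UNIV * u - (\<Sum>y\<in>A. exp (a P y) * (a R y - a P y)) / F P \<le> u"
      using KKT[OF R] Q Fpos[of P] by (simp add: pd_def)
    finally show ?thesis .
  qed
  \<comment> \<open>\<open>ln_le_umlaut\<close> asks for full support, which the minimiser may lack.
    Mixing with the uniform distribution provides it, and continuity of \<open>F\<close> along the
    segment recovers \<open>u\<close> in the limit.\<close>
  define P' where "P' s x = (1 - s) * P x + s * (1 / real CARD('x))" for s x
  have "ereal u \<le> umlaut W"
  proof -
    have "isCont (\<lambda>s. F (P' s)) 0" unfolding P'_def using DERIV_isCont[OF F_mix] .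
    then have "isCont (\<lambda>s. - ln (F (P' s))) 0" using Fpos by (intro continuous_intros) (auto simp: less_imp_neq[symmetric])
    moreover have "P' 0 = P" by (rule ext) (simp add: P'_def)
    ultimately have "((\<lambda>s. - ln (F (P' s))) \<longlongrightarrow> u) (at 0)" by (simp add: isCont_def u_def)
    then have "((\<lambda>s. - ln (F (P' s))) \<longlongrightarrow> u) (at_right 0)"
      by (rule filterlim_mono) (auto simp: at_le)
    then have "((\<lambda>s. ereal (- ln (F (P' s)))) \<longlongrightarrow> ereal u) (at_right 0)" by simp
    moreover have "\<forall>\<^sub>F s in at_right 0. ereal (- ln (F (P' s))) \<le> umlaut W"
    proof -
      have "\<forall>\<^sub>F s in at_right 0. 0 < s \<and> s < (1::real)"
        by (intro eventually_conj eventually_at_right_less)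
          (auto simp: eventually_at_right_field intro!: exI[of _ 1])
      then show ?thesis
      proof eventually_elim
        case (elim s)
        have "pd (P' s)" unfolding P'_def using elim by (intro pd_mix P pd_uniform) auto
        moreover have "0 < P' s x" for x
          using elim P unfolding P'_def by (intro add_nonneg_pos mult_nonneg_nonneg mult_pos_pos) (auto simp: pd_def)
        ultimately show ?case
          using ln_le_umlaut[OF W] ne unfolding F_def a_def A_def by blast
      qed
    qed
    ultimately show ?thesis by (rule tendsto_upperbound) simp
  qed
  moreover have "W x y \<noteq> 0" if "0 < Q y" for x y
    using that by (auto simp: Q_def A_def split: if_splits)
  ultimately show ?thesis using that Q Qx by blast
qed

text \<open>The log-likelihood ratio \<open>L\<close> has mean at most \<open>n u\<close> under the
  product of \<open>Q\<close>, for every input word. Where \<open>L\<close> is at most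
  \<open>n v\<close>, the minimum is \<open>t\<close> times that product. A linear minorant in
  \<open>L\<close> replaces a concentration argument, at the price of the extra \<open>1\<close> in
  the numerator.\<close>

lemma sum_min_chan_pow_ge:
  fixes W :: "'x::finite \<Rightarrow> 'y::finite \<Rightarrow> real"
  assumes W: "is_channel W" and Q: "pd Q" and nz: "\<And>x y. 0 < Q y \<Longrightarrow> W x y \<noteq> 0"
    and D: "\<And>x. (\<Sum>y\<in>UNIV. Q y * (ln (Q y) - ln (W x y))) \<le> u" and v: "0 < v" and n: "0 < n"
  defines "t \<equiv> exp (- (real n * v))"
  shows "t * (1 - (real n * u + 1) / (real n * v))
    \<le> (\<Sum>ys\<in>words n. min (chan_pow W n xs ys) (t * (\<Prod>i<n. Q (ys ! i))))"
proof -
  define Qn where "Qn ys = (\<Prod>i<n. Q (ys ! i))" for ys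
  define V where "V ys = chan_pow W n xs ys" for ys
  define L where "L ys = (\<Sum>i<n. ln (Q (ys ! i)) - ln (W (xs ! i) (ys ! i)))" for ys
  define m where "m = real n * v"
  have m: "0 < m" using v n by (simp add: m_def)
  have t: "0 < t" by (simp add: t_def)
  have Q0: "0 \<le> Q y" and Q1: "sum Q UNIV = 1" for y using Q by (auto simp: pd_def)
  have V0: "0 \<le> V ys" for ys by (simp add: V_def W chan_pow_nonneg)
  \<comment> \<open>Markov's inequality in pointwise form; the term V ys / m compensates for the negative
    values of the log-likelihood ratio L.\<close>
  have point: "t * (Qn ys * (1 - L ys / m) - V ys / m) \<le> min (V ys) (t * Qn ys)" for ys
  proof (cases "\<exists>i<n. Q (ys ! i) = 0")
    case True
    then have "Qn ys = 0" by (auto simp: Qn_def)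
    moreover have "0 \<le> V ys / m" using V0 m by simp
    ultimately have "t * (Qn ys * (1 - L ys / m) - V ys / m) \<le> 0"
      using t by (intro mult_nonneg_nonpos) auto
    also have "0 \<le> min (V ys) (t * Qn ys)" using \<open>Qn ys = 0\<close> V0[of ys] by simp
    finally show ?thesis .
  next
    case False
    then have Qp: "0 < Q (ys ! i)" if "i < n" for i using that Q0[of "ys ! i"] by (auto simp: order_less_le)
    then have Wp: "0 < W (xs ! i) (ys ! i)" if "i < n" for i
      using that nz W by (auto simp: is_channel_def order_less_le)
    have Qn: "0 < Qn ys" unfolding Qn_def using Qp by (intro prod_pos) auto
    have "exp (- L ys) = (\<Prod>i<n. exp (ln (W (xs ! i) (ys ! i)) - ln (Q (ys ! i))))"
      unfolding L_def by (simp add: exp_sum[symmetric] sum_negf[symmetric])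
    also have "\<dots> = (\<Prod>i<n. W (xs ! i) (ys ! i) / Q (ys ! i))"
      using Qp Wp by (intro prod.cong) (auto simp: exp_diff)
    also have "\<dots> = V ys / Qn ys" by (simp add: prod_dividef V_def Qn_def chan_pow_def)
    finally have V: "V ys = Qn ys * exp (- L ys)" using Qn by simp
    show ?thesis
    proof (cases "L ys \<le> m")
      case True
      then have "t \<le> exp (- L ys)" by (simp add: t_def m_def)
      then have "t * Qn ys \<le> V ys" unfolding V using Qn by simp
      moreover have "1 - L ys \<le> exp (- L ys)" using exp_ge_add_one_self[of "- L ys"] by simp
      then have "0 \<le> L ys + exp (- L ys)" using exp_gt_zero[of "- L ys"] by (smt (verit))
      then have "0 \<le> Qn ys * ((L ys + exp (- L ys)) / m)" using Qn m by simp
      then have "Qn ys * (1 - L ys / m) - V ys / m \<le> Qn ys" unfolding V by (simp add: algebra_simps add_divide_distrib)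
      then have "t * (Qn ys * (1 - L ys / m) - V ys / m) \<le> t * Qn ys" using t by simp
      ultimately show ?thesis by simp
    next
      case False
      then have "1 - L ys / m \<le> 0" using m by simp
      then have "Qn ys * (1 - L ys / m) - V ys / m \<le> 0"
        using Qn V0[of ys] m by (smt (verit) divide_nonneg_pos mult_nonneg_nonpos)
      then have "t * (Qn ys * (1 - L ys / m) - V ys / m) \<le> 0" using t by (simp add: mult_nonneg_nonpos)
      also have "0 \<le> min (V ys) (t * Qn ys)" using t Qn V0[of ys] by simp
      finally show ?thesis .
    qed
  qed
  have Qn1: "sum Qn (words n) = 1"
    unfolding Qn_def by (subst sum_words_prod) (simp add: Q1)
  have L: "(\<Sum>ys\<in>words n. Qn ys * L ys) \<le> real n * u"
  proof -
    have "(\<Sum>ys\<in>words n. Qn ys * L ys) = (\<Sum>i<n. \<Sum>y\<in>UNIV. Q y * (ln (Q y) - ln (W (xs ! i) y)))"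
      unfolding Qn_def L_def
      using sum_words_prod_sum[OF Q1, where f = "\<lambda>i y. ln (Q y) - ln (W (xs ! i) y)"] .
    also have "\<dots> \<le> (\<Sum>i<n. u)" by (intro sum_mono D)
    finally show ?thesis by simp
  qed
  have "t * (1 - (real n * u + 1) / m) \<le> t * (1 - ((\<Sum>ys\<in>words n. Qn ys * L ys) + 1) / m)"
    using t m L by (intro mult_left_mono diff_left_mono divide_right_mono) auto
  also have "\<dots> = (\<Sum>ys\<in>words n. t * (Qn ys * (1 - L ys / m) - V ys / m))"
  proof -
    have "(\<Sum>ys\<in>words n. Qn ys * (1 - L ys / m) - V ys / m)
       = sum Qn (words n) - (\<Sum>ys\<in>words n. Qn ys * L ys) / m - sum V (words n) / m"
      by (simp add: algebra_simps sum_subtractf sum.distrib sum_divide_distrib)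
    then show ?thesis
      using sum_chan_pow[OF W, of n xs]
      by (simp add: sum_distrib_left[symmetric] Qn1 V_def[symmetric] add_divide_distrib)
  qed
  also have "\<dots> \<le> (\<Sum>ys\<in>words n. min (V ys) (t * Qn ys))" by (intro sum_mono point)
  finally show ?thesis by (simp add: V_def Qn_def m_def)
qed

text \<open>\<open>K\<close> is chosen before the sequence \<open>M\<close>, so one bound serves
  both a large constant number of messages and an exponentially growing one.\<close>

lemma Liminf_rate_le_umlaut:
  fixes W :: "'x::finite \<Rightarrow> 'y::finite \<Rightarrow> real"
  assumes W: "is_channel W" and B: "umlaut W < ereal B"
  obtains K where "\<And>M. eventually (\<lambda>n. K \<le> real (M n)) sequentially
      \<Longrightarrow> Liminf sequentially (\<lambda>n. rate n (eps_NS_n W (M n) n)) \<le> ereal B"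
proof -
  have ne: "{y. \<forall>x. W x y \<noteq> 0} \<noteq> {}" using umlaut_eq_infinity[of W] B by fastforce
  obtain Q u where Q: "pd Q" and u: "ereal u \<le> umlaut W"
    and nz: "\<And>x y. 0 < Q y \<Longrightarrow> W x y \<noteq> 0"
    and D: "\<And>x. (\<Sum>y\<in>UNIV. Q y * (ln (Q y) - ln (W x y))) \<le> u"
    using umlaut_saddle_output[OF W ne] by metis
  have "ereal u < ereal B" using u B by (rule order_le_less_trans)
  then have uB: "u < B" by simp
  \<comment> \<open>The relative entropy of \<open>Q\<close> with respect to \<open>W x0\<close> is
    nonnegative; this makes \<open>v\<close> positive.\<close>
  have "0 \<le> u"
  proof -
    fix x0 :: 'x
    define A where "A = {y. W x0 y \<noteq> 0}"
    have "(\<Sum>y\<in>A. exp (ln (W x0 y))) = (\<Sum>y\<in>A. W x0 y)"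
      using W by (intro sum.cong) (auto simp: A_def is_channel_def order_less_le)
    also have "\<dots> = (\<Sum>y\<in>UNIV. W x0 y)"
      by (intro sum.mono_neutral_left) (auto simp: A_def)
    also have "\<dots> = 1" using W by (simp add: is_channel_def)
    finally have "0 = - ln (\<Sum>y\<in>A. exp (ln (W x0 y)))" by simp
    also have "\<dots> \<le> (\<Sum>y\<in>UNIV. Q y * (ln (Q y) - ln (W x0 y)))"
      by (rule Gibbs_variational[OF Q]) (use nz ne in \<open>auto simp: A_def\<close>)
    also have "\<dots> \<le> u" by (rule D)
    finally show ?thesis .
  qed
  \<comment> \<open>\<open>v\<close> lies strictly between \<open>u\<close> and \<open>B\<close>,
    and \<open>d = 1 - u / v\<close> is the limiting factor in the bound on the minima. Of it,
    \<open>d / 2\<close> is given up to the term \<open>1 / (n v)\<close> and \<open>d / 4\<close>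
    to \<open>1 / M\<close>, leaving \<open>d / 4\<close>.\<close>
  define v where "v = (u + B) / 2"
  define d where "d = (v - u) / v"
  have v: "u < v" "v < B" "0 < v" using uB \<open>0 \<le> u\<close> by (auto simp: v_def)
  have d: "0 < d" using v by (simp add: d_def)
  have bound: "exp (- (real n * v)) * (d / 4) \<le> eps_NS_n W m n"
    if m: "max 2 (4 / d) \<le> real m" and n: "2 / (v - u) \<le> real n" for m n
  proof -
    define t where "t = exp (- (real n * v))"
    have t: "0 < t" by (simp add: t_def)
    have "0 < 2 / (v - u)" using v by simp
    then have n0: "0 < n" using n by (metis linorder_not_le of_nat_0 of_nat_0_less_iff order_less_le_trans)
    have Q1: "sum Q UNIV = 1" using Q by (simp add: pd_def)
    have "1 / (real n * v) \<le> d / 2"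
      using n n0 v by (simp add: d_def field_simps)
    moreover have "1 - (real n * u + 1) / (real n * v) = d - 1 / (real n * v)"
      using n0 v by (simp add: d_def field_simps)
    ultimately have c: "d / 2 \<le> 1 - (real n * u + 1) / (real n * v)" by simp
    have "t * (d / 2) \<le> (\<Sum>ys\<in>words n. min (chan_pow W n xs ys) (t * (\<Prod>i<n. Q (ys ! i))))" for xs
      using mult_left_mono[OF c, of t] t
        sum_min_chan_pow_ge[OF W Q nz D v(3) n0, of xs, folded t_def] by linarith
    then have "t * (d / 2) - (\<Sum>ys\<in>words n. t * (\<Prod>i<n. Q (ys ! i))) / real m \<le> eps_NS_n W m n"
      using m by (intro eps_NS_n_ge W) auto
    moreover have "(\<Sum>ys\<in>words n. t * (\<Prod>i<n. Q (ys ! i))) = t"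
      by (simp add: sum_distrib_left[symmetric] sum_words_prod[of "\<lambda>_. Q" n] Q1)
    moreover have "1 / real m \<le> d / 4" using m d by (simp add: field_simps)
    then have "t * (1 / real m) \<le> t * (d / 4)" using t by (intro mult_left_mono) auto
    ultimately show ?thesis by (simp add: t_def[symmetric])
  qed
  show ?thesis
  proof (rule that[of "max 2 (4 / d)"])
    fix M :: "nat \<Rightarrow> nat" assume M: "eventually (\<lambda>n. max 2 (4 / d) \<le> real (M n)) sequentially"
    have "((\<lambda>n. v - ln (d / 4) / real n) \<longlongrightarrow> v - 0) sequentially"
      by (intro tendsto_intros lim_const_over_n)
    then have ev: "\<forall>\<^sub>F n in sequentially. v - ln (d / 4) / real n < B"
      using v by (intro order_tendstoD(2)) auto
    have "\<forall>\<^sub>F n in sequentially. 2 / (v - u) \<le> real n"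
      using filterlim_real_sequentially by (simp add: filterlim_at_top)
    with M ev have "\<forall>\<^sub>F n in sequentially. rate n (eps_NS_n W (M n) n) \<le> ereal B"
      using eventually_gt_at_top[of 0]
    proof eventually_elim
      case (elim n)
      have b: "exp (- (real n * v)) * (d / 4) \<le> eps_NS_n W (M n) n"
        using bound elim by blast
      have b0: "0 < exp (- (real n * v)) * (d / 4)" using d by simp
      then have "- ln (eps_NS_n W (M n) n) / real n \<le> - ln (exp (- (real n * v)) * (d / 4)) / real n"
        using b by (intro divide_right_mono) auto
      also have "ln (exp (- (real n * v)) * (d / 4)) = - (real n * v) + ln (d / 4)"
        using d by (subst ln_mult) auto
      also have "- (- (real n * v) + ln (d / 4)) / real n = v - ln (d / 4) / real n"
        using elim by (simp add: diff_divide_distrib)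
      finally show ?case using b b0 elim by (simp add: rate_def)
    qed
    then show "Liminf sequentially (\<lambda>n. rate n (eps_NS_n W (M n) n)) \<le> ereal B"
      by (rule Liminf_le[OF sequentially_bot])
  qed
qed

section \<open>Comparison of the exponents\<close>

lemma E_NS_zero_le_umlaut:
  assumes W: "is_channel W"
  shows "E_NS_zero W \<le> umlaut W"
proof (rule dense_ge)
  fix z assume "umlaut W < z"
  then obtain B where B: "umlaut W < ereal B" "ereal B < z" using ereal_dense2 by blast
  obtain K where K: "\<And>M. eventually (\<lambda>n. K \<le> real (M n)) sequentially
      \<Longrightarrow> Liminf sequentially (\<lambda>n. rate n (eps_NS_n W (M n) n)) \<le> ereal B"
    using Liminf_rate_le_umlaut[OF W B(1)] by blast
  have "\<forall>\<^sub>F m in sequentially. K \<le> real m"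
    using filterlim_real_sequentially by (simp add: filterlim_at_top)
  then have "\<forall>\<^sub>F m in sequentially. Liminf sequentially (\<lambda>n. rate n (eps_NS_n W m n)) \<le> ereal B"
    by eventually_elim (use K[of "\<lambda>_. m" for m] in simp)
  then have "E_NS_zero W \<le> ereal B"
    unfolding E_NS_zero_def by (rule Liminf_le[OF sequentially_bot])
  then show "E_NS_zero W \<le> z" using B(2) by simp
qed

lemma E_NS_le_umlaut:
  assumes W: "is_channel W" and r: "0 < r"
  shows "E_NS W r \<le> umlaut W"
proof (rule dense_ge)
  fix z assume "umlaut W < z"
  then obtain B where B: "umlaut W < ereal B" "ereal B < z" using ereal_dense2 by blast
  obtain K where K: "\<And>M. eventually (\<lambda>n. K \<le> real (M n)) sequentially
      \<Longrightarrow> Liminf sequentially (\<lambda>n. rate n (eps_NS_n W (M n) n)) \<le> ereal B"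
    using Liminf_rate_le_umlaut[OF W B(1)] by blast
  have "filterlim (\<lambda>n. exp (r * real n)) at_top sequentially"
    by (rule filterlim_compose[OF exp_at_top])
      (rule filterlim_tendsto_pos_mult_at_top[OF tendsto_const r filterlim_real_sequentially])
  then have "\<forall>\<^sub>F n in sequentially. K \<le> exp (r * real n)" by (simp add: filterlim_at_top)
  then have "\<forall>\<^sub>F n in sequentially. K \<le> real (nat \<lceil>exp (r * real n)\<rceil>)"
    by eventually_elim (use real_nat_ceiling_ge order_trans in blast)
  from K[OF this] have "E_NS W r \<le> ereal B" by (simp add: E_NS_def)
  then show "E_NS W r \<le> z" using B(2) by simp
qed

lemma E_sp_le_E_NS:
  assumes W: "is_channel W" and r: "0 < r"
  shows "E_sp W r \<le> E_NS W r"
  unfolding E_NS_def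
\<comment> \<open>The constant \<open>2\<close> absorbs the ceiling, as the exponential is at least
  one.\<close>
proof (rule E_sp_le_Liminf_rate[OF W, of _ 2])
  fix n :: nat
  have e: "1 \<le> exp (r * real n)" using r by simp
  have "real (nat \<lceil>exp (r * real n)\<rceil>) \<le> exp (r * real n) + 1"
    using e by linarith
  then show "real (nat \<lceil>exp (r * real n)\<rceil>) \<le> 2 * exp (r * real n)" using e by linarith
  assume "0 < n"
  then have "1 < exp (r * real n)" using r by simp
  then have "1 < real (nat \<lceil>exp (r * real n)\<rceil>)" using real_nat_ceiling_ge order_less_le_trans by blast
  then show "2 \<le> nat \<lceil>exp (r * real n)\<rceil>" by linarith
qed simp

text \<open>A fixed number \<open>m\<close> of messages is below \<open>m * exp (r * n)\<close> for
  every positive \<open>r\<close>, so \<open>C = m\<close> serves.\<close>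

lemma E_sp_le_E_NS_zero:
  assumes W: "is_channel W" and r: "0 < r"
  shows "E_sp W r \<le> E_NS_zero W"
  unfolding E_NS_zero_def
proof (rule Liminf_bounded)
  show "\<forall>\<^sub>F m in sequentially. E_sp W r \<le> Liminf sequentially (\<lambda>n. rate n (eps_NS_n W m n))"
    using eventually_ge_at_top[of 2]
  proof eventually_elim
    case (elim m)
    show ?case
      by (rule E_sp_le_Liminf_rate[OF W, of _ "real m"]) (use elim r in auto)
  qed
qed

theorem mainTheorem1:
  fixes W :: "'x::finite \<Rightarrow> 'y::finite \<Rightarrow> real"
  assumes "is_channel W"
  shows "E_NS_zero W = E_NS_0plus W \<and> E_NS_0plus W = umlaut W
         \<and> ((E_sp W) \<longlongrightarrow> umlaut W) (at_right 0)"
proof -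
  note W = assms
  have pos: "\<forall>\<^sub>F r in at_right 0. 0 < (r::real)" by (rule eventually_at_right_less)
  have nb: "at_right (0::real) \<noteq> bot" by simp
  \<comment> \<open>\<open>E_NS_zero W\<close> does not depend on \<open>r\<close>, so it bounds
    even the upper limit of \<open>E_sp W\<close>; this closes the chain that yields convergence and
    not only a value of the lower limit.\<close>
  have sp_le_zero: "Limsup (at_right 0) (E_sp W) \<le> E_NS_zero W"
    by (rule Limsup_bounded) (rule eventually_mono[OF pos E_sp_le_E_NS_zero[OF W]])
  have sp_le_plus: "Liminf (at_right 0) (E_sp W) \<le> E_NS_0plus W"
    unfolding E_NS_0plus_def
    by (rule Liminf_mono) (rule eventually_mono[OF pos E_sp_le_E_NS[OF W]])
  have plus_le: "E_NS_0plus W \<le> umlaut W"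
    unfolding E_NS_0plus_def
    by (rule Liminf_le[OF nb]) (rule eventually_mono[OF pos E_NS_le_umlaut[OF W]])
  note sp_ge = umlaut_le_Liminf_E_sp[OF W]
  note zero_le = E_NS_zero_le_umlaut[OF W]
  have le: "Liminf (at_right 0) (E_sp W) \<le> Limsup (at_right 0) (E_sp W)"
    by (rule Liminf_le_Limsup[OF nb])
  have "E_NS_0plus W = umlaut W" using plus_le sp_ge sp_le_plus by (intro antisym) auto
  moreover have "E_NS_zero W = umlaut W"
    using zero_le sp_ge le sp_le_zero by (intro antisym) auto
  moreover have "(E_sp W \<longlongrightarrow> umlaut W) (at_right 0)"
  proof (rule Liminf_eq_Limsup[OF nb])
    show "Liminf (at_right 0) (E_sp W) = umlaut W" "Limsup (at_right 0) (E_sp W) = umlaut W"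
      using sp_ge le sp_le_zero zero_le by auto
  qed
  ultimately show ?thesis by simp
qed

end
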